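(* Let $d\ge1$, $k\in\{1,\dots,d\}$, $p\ge1$, let $\{\mu_\theta:\theta\in\Theta\}\subseteq\mathscr{P}(\mathbb{R}^d)$ be a statistical model, and let $\widehat{\mu}_n=\frac1n\sum_{i=1}^n\delta_{X_i}$ be the empirical measures of the data. Assume: (1) there exists $\mu_\star\in\mathscr{P}(\mathbb{R}^d)$ such that the data-generating process satisfies $\lim_{n\to+\infty}\mathcal{W}_p(\widehat{\mu}_n,\mu_\star)=0$ almost surely; (2) the map $\theta\mapsto\mu_\theta$ is continuous: $\|\theta_n-\theta\|_\Theta\to0$ implies $\mu_{\theta_n}\Rightarrow\mu_\theta$; (3) there exists $\tau>0$ such that the set $\Theta_\star(\tau)=\{\theta\in\Theta:\overline{\mathcal{PW}}_{p,k}(\mu_\star,\mu_\theta)\le\inf_{\theta'\in\Theta}\overline{\mathcal{PW}}_{p,k}(\mu_\star,\mu_{\theta'})+\tau\}$ is bounded. Then there exists an event $\Omega$ with $\mathbb{P}(\Omega)=1$ such that, for all $\omega\in\Omega$, $$\lim_{n\to+\infty}\inf_{\theta\in\Theta}\overline{\mathcal{PW}}_{p,k}(\widehat{\mu}_n(\omega),\mu_\theta)=\inf_{\theta\in\Theta}\overline{\mathcal{PW}}_{p,k}(\mu_\star,\mu_\theta)$$ and $$\limsup_{n\to+\infty}\ \operatorname*{argmin}_{\theta\in\Theta}\overline{\mathcal{PW}}_{p,k}(\widehat{\mu}_n(\omega),\mu_\theta)\subseteq\operatorname*{argmin}_{\theta\in\Theta}\overline{\mathcal{PW}}_{p,k}(\mu_\star,\mu_\theta).$$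 In addition, for each $\omega\in\Omega$ there is $n(\omega)>0$ such that $\operatorname*{argmin}_{\theta\in\Theta}\overline{\mathcal{PW}}_{p,k}(\widehat{\mu}_n(\omega),\mu_\theta)\ne\emptyset$ for all $n\ge n(\omega)$.
   Context: $\|\cdot\|$ is the Euclidean norm, $\Rightarrow$ denotes weak convergence, $\mathscr{P}(\mathbb{R}^d)$ is the set of Borel probability measures on $\mathbb{R}^d$. $\mathcal{W}_p(\mu,\nu)=\left(\inf_{\pi\in\Pi(\mu,\nu)}\int\|x-y\|^p d\pi(x,y)\right)^{1/p}$ is the Wasserstein distance of order $p$ ($\Pi(\mu,\nu)$: couplings). $\mathbb{S}_{d,k}=\{E\in\mathbb{R}^{d\times k}:E^\top E=I_k\}$, $E^\star_{\#}\mu$ is the push-forward of $\mu$ under $x\mapsto E^\top x$, and $\overline{\mathcal{PW}}_{p,k}(\mu,\nu)=\sup_{E\in\mathbb{S}_{d,k}}\mathcal{W}_p(E^\star_{\#}\mu,E^\star_{\#}\nu)$ is the projection robust Wasserstein distance. Standing conditions on the model: $(\Theta,\|\cdot\|_\Theta)$ is a Polish space; $\Theta$ is $\sigma$-compact; parameters are identifiable ($\mu_\theta=\mu_{\theta'}$ implies $\theta=\theta'$). The data $X_1,X_2,\dots$ are i.i.d. from $\mu_\star$; the model may be misspecified, i.e. $\mu_\star$ need not be one of the $\mu_\theta$. For a sequence of sets $A_n\subseteq\Theta$, $\limsup_{n\to\infty}A_n$ is the outer limit: the set of all $\theta\in\Theta$ that are limits of some sequence $\theta_{n_j}\in A_{n_j}$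 along a subsequence $n_1<n_2<\cdots$.
   Formalization: Θ is additionally assumed to be a complete metric space in which closed bounded sets are compact; for a general Polish σ-compact Θ, boundedness of Θ_⋆(τ) does not ensure that the argmin sets are nonempty (e.g. Θ = ℕ with the discrete metric and μ_m = δ_{1+1/(m+1)}, μ_⋆ = δ_0). *)

theory Defs
  imports "HOL-Probability.Probability"
begin

text \<open>
  Borel probability measures on a space are the elements of
  \<open>space (prob_algebra borel)\<close>. All transport costs take values in \<open>ennreal\<close>,
  since the measures of the model need not have finite moments of order \<open>p\<close>.
\<close>

definition couplings :: "'a::euclidean_space measure \<Rightarrow> 'a measure \<Rightarrow> ('a \<times> 'a) measure set" where
  "couplings \<mu> \<nu> = {\<pi> \<in> space (prob_algebra (borel \<Otimes>\<^sub>M borel)).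
     distr \<pi> borel fst = \<mu> \<and> distr \<pi> borel snd = \<nu>}"

definition ennreal_powr :: "ennreal \<Rightarrow> real \<Rightarrow> ennreal" where
  "ennreal_powr x a = (if x = \<infinity> then \<infinity> else ennreal (enn2real x powr a))"

definition wasserstein :: "real \<Rightarrow> 'a::euclidean_space measure \<Rightarrow> 'a measure \<Rightarrow> ennreal" where
  "wasserstein p \<mu> \<nu> =
     ennreal_powr (INF \<pi>\<in>couplings \<mu> \<nu>. \<integral>\<^sup>+ z. ennreal (norm (fst z - snd z) powr p) \<partial>\<pi>) (1 / p)"

text \<open>Matrices with \<open>d\<close> rows and \<open>k\<close> columns have type \<open>real ^ 'k ^ 'd\<close>.\<close>

definition stiefel :: "(real ^ 'k ^ 'd) set" where
  "stiefel = {E. transpose E ** E = mat 1}"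

definition proj_measure :: "real ^ 'k ^ 'd \<Rightarrow> (real ^ 'd) measure \<Rightarrow> (real ^ 'k) measure" where
  "proj_measure E \<mu> = distr \<mu> borel (\<lambda>x. transpose E *v x)"

text \<open>The first argument only carries the projection dimension \<open>k = CARD('k)\<close>.\<close>

definition PRW ::
    "'k::finite itself \<Rightarrow> real \<Rightarrow> (real ^ 'd) measure \<Rightarrow> (real ^ 'd) measure \<Rightarrow> ennreal" where
  "PRW k p \<mu> \<nu> =
     (SUP E\<in>(stiefel :: (real ^ 'k ^ 'd) set). wasserstein p (proj_measure E \<mu>) (proj_measure E \<nu>))"

definition weakly_converges ::
    "(nat \<Rightarrow> 'a::topological_space measure) \<Rightarrow> 'a measure \<Rightarrow> bool" where
  "weakly_converges \<mu>s \<mu> \<longleftrightarrow>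
     (\<forall>f :: 'a \<Rightarrow> real. continuous_on UNIV f \<and> bounded (range f) \<longrightarrow>
        (\<lambda>n. \<integral>x. f x \<partial>\<mu>s n) \<longlonglongrightarrow> (\<integral>x. f x \<partial>\<mu>))"

text \<open>
  The points are \<open>x 1, \<dots>, x n\<close>, with multiplicity: the measure is the law of \<open>x i\<close> for an index
  \<open>i\<close> chosen uniformly. For \<open>n = 0\<close> it is the null measure.
\<close>

definition empirical_measure :: "nat \<Rightarrow> (nat \<Rightarrow> 'a::topological_space) \<Rightarrow> 'a measure" where
  "empirical_measure n x = distr (uniform_count_measure {1..n}) borel x"

lemma emeasure_empirical_measure:
  assumes "A \<in> sets borel"
  shows "emeasure (empirical_measure n x) A =
           (\<Sum>i=1..n. emeasure (return borel (x i)) A) / of_nat n"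
proof -
  let ?I = "x -` A \<inter> {1..n}"
  have "emeasure (empirical_measure n x) A = emeasure (uniform_count_measure {1..n}) ?I"
    unfolding empirical_measure_def using assms
    by (subst emeasure_distr) (auto simp: uniform_count_measure_def space_point_measure)
  also have "\<dots> = of_nat (card ?I) / of_nat n"
    by (cases "n = 0")
       (auto simp: emeasure_uniform_count_measure divide_ennreal ennreal_of_nat_eq_real_of_nat)
  also have "of_nat (card ?I) = (\<Sum>i=1..n. emeasure (return borel (x i)) A)"
    using assms by (simp add: indicator_def sum.If_cases Int_def vimage_def conj_commute)
  finally show ?thesis .
qed

text \<open>A constant function, even with value \<open>\<infinity>\<close>, is minimized at every point.\<close>

definition argmin_set :: "('t \<Rightarrow> 'b::order) \<Rightarrow> 't set" where
  "argmin_set f = {\<theta>. is_arg_min f (\<lambda>_. True) \<theta>}"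

definition outer_limit :: "(nat \<Rightarrow> 't::topological_space set) \<Rightarrow> 't set" where
  "outer_limit A = {\<theta>. \<exists>(r :: nat \<Rightarrow> nat) t.
     strict_mono r \<and> (\<forall>j. t j \<in> A (r j)) \<and> t \<longlonglongrightarrow> \<theta>}"

definition sigma_compact :: "'t::topological_space set \<Rightarrow> bool" where
  "sigma_compact S \<longleftrightarrow> (\<exists>K :: nat \<Rightarrow> 't set. (\<forall>n. compact (K n)) \<and> (\<Union>n. K n) = S)"

text \<open>
  In an arbitrary metric space boundedness does not control anything: the natural numbers with the
  discrete metric are Polish, \<open>\<sigma>\<close>-compact and bounded, and minimizers over them need not exist.
  Boundedness of a set of parameters is meant as it is in finite-dimensional normed spaces and their
  closed subsets.
\<close>

definition closed_bounded_compact :: "'t::metric_space itself \<Rightarrow> bool" where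
  "closed_bounded_compact T \<longleftrightarrow> (\<forall>S :: 't set. closed S \<and> bounded S \<longrightarrow> compact S)"

end

theory Submission
  imports Defs
begin

text \<open>
  Let \<open>e n\<close> be the projection robust distance between the \<open>n\<close>-th empirical measure and the data law;
  it is at most the Wasserstein distance and tends to \<open>0\<close> almost surely. The triangle inequality
  bounds the difference of the empirical and the limiting objective by \<open>e n\<close>, uniformly in
  the parameter. This gives convergence of the infima and puts approximate
  minimizers of the empirical objective into the bounded level set, whose closure is compact. Since
  only the empirical objectives, up to an error \<open>2 * e n\<close>, need to be lower semicontinuous, one
  marginal of every transport problem is finitely supported. For such problems lower semicontinuity
  follows from duality: the dual integrand \<open>min_i (c (x_i, y) + \<psi>_i)\<close> is continuous and bounded
  below, so neither Prokhorov's theorem nor a general duality theorem is needed. Entropic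
  regularization supplies the dual potential together with a nearly optimal coupling: an exact scaling
  of the softmin weights is the minimizer of a convex coercive function of finitely many variables.
\<close>

section \<open>Scaling positive functions to prescribed integrals\<close>

text \<open>The obstacle is that model measures may lack moments, so that costs and objectives may
  be infinite and cannot be treated as real integrable quantities. Normalizing the softmin weights
  pointwise keeps the logarithms of the scaling problem bounded, however fast the cost grows. An
  exact scaling gives a conditional law of the index \<open>i\<close> given \<open>y\<close> whose
  average of \<open>c (x_i, y) + \<psi>_i\<close> exceeds the minimum by at most
  \<open>n * \<eta>\<close>, where \<open>\<eta>\<close> is the temperature. This is an approximate
  form of complementary slackness. A dual potential has three uses: it comes with a nearly optimal
  coupling, it provides the test function for weak convergence, and it carries the triangle
  inequality across an arbitrary middle measure. Two triangle inequalities are needed, with the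
  empirical measure at an end and in the middle; in the second case the gluing happens at atoms. The
  data law need not be discrete, so duality is never applied to the limiting objective; its
  behaviour along convergent parameters is read off from the empirical objectives.\<close>

lemma weighted_exp_sum_bounds:
  fixes q :: "'i \<Rightarrow> real"
  assumes "finite I" "\<And>i. i \<in> I \<Longrightarrow> q i \<ge> 0" "(\<Sum>i\<in>I. q i) = 1"
    "\<And>i. i \<in> I \<Longrightarrow> lo \<le> u i" "\<And>i. i \<in> I \<Longrightarrow> u i \<le> hi"
  shows "exp lo \<le> (\<Sum>i\<in>I. q i * exp (u i))" "(\<Sum>i\<in>I. q i * exp (u i)) \<le> exp hi"
proof -
  have "exp lo = (\<Sum>i\<in>I. q i * exp lo)" using assms(3) by (simp flip: sum_distrib_right)
  also have "\<dots> \<le> (\<Sum>i\<in>I. q i * exp (u i))" using assms by (intro sum_mono mult_left_mono) auto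
  finally show "exp lo \<le> (\<Sum>i\<in>I. q i * exp (u i))" .
  have "(\<Sum>i\<in>I. q i * exp (u i)) \<le> (\<Sum>i\<in>I. q i * exp hi)"
    using assms by (intro sum_mono mult_left_mono) auto
  also have "\<dots> = exp hi" using assms(3) by (simp flip: sum_distrib_right)
  finally show "(\<Sum>i\<in>I. q i * exp (u i)) \<le> exp hi" .
qed

text \<open>The weights \<open>q i y\<close> sum to 1 for every \<open>y\<close>, so
  \<open>Z u y\<close> below is a mean of the numbers \<open>exp (u i)\<close>. Hence
  \<open>ln (Z u y)\<close> lies between the least and the largest \<open>u i\<close>, uniformly in
  \<open>y\<close>, and is integrable without any growth condition on the cost behind
  \<open>q\<close>.\<close>

locale scaling_problem = prob_space M for M :: "'a measure" +
  fixes I :: "'i set" and q :: "'i \<Rightarrow> 'a \<Rightarrow> real" and w :: "'i \<Rightarrow> real"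
  assumes finite_I: "finite I" and I_ne: "I \<noteq> {}"
    and q_meas [measurable]: "\<And>i. i \<in> I \<Longrightarrow> q i \<in> borel_measurable M"
    and q_pos: "\<And>i y. i \<in> I \<Longrightarrow> y \<in> space M \<Longrightarrow> q i y > 0"
    and q_sum: "\<And>y. y \<in> space M \<Longrightarrow> (\<Sum>i\<in>I. q i y) = 1"
    and w_pos: "\<And>i. i \<in> I \<Longrightarrow> w i > 0"
    and w_sum: "(\<Sum>i\<in>I. w i) = 1"
begin

definition Z :: "('i \<Rightarrow> real) \<Rightarrow> 'a \<Rightarrow> real" where
  "Z u y = (\<Sum>i\<in>I. q i y * exp (u i))"

text \<open>
  \<open>F\<close> is convex, and its partial derivative in direction \<open>i\<close> is
  \<open>\<integral> q i * exp (u i) / Z u - w i\<close>, so that the minimizers are the scalings that are sought.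
  The weights being positive makes \<open>F\<close> coercive modulo constants.
\<close>

definition F :: "('i \<Rightarrow> real) \<Rightarrow> real" where
  "F u = (\<integral>y. ln (Z u y) \<partial>M) - (\<Sum>i\<in>I. w i * u i)"

lemma Z_pos: "y \<in> space M \<Longrightarrow> Z u y > 0"
  unfolding Z_def using finite_I I_ne q_pos by (intro sum_pos) auto

lemma Z_meas [measurable]: "Z u \<in> borel_measurable M"
  unfolding Z_def[abs_def] by measurable

lemma ln_Z_bounds:
  assumes "y \<in> space M" "\<And>i. i \<in> I \<Longrightarrow> lo \<le> u i" "\<And>i. i \<in> I \<Longrightarrow> u i \<le> hi"
  shows "lo \<le> ln (Z u y)" "ln (Z u y) \<le> hi"
proof -
  have "exp lo \<le> Z u y" "Z u y \<le> exp hi" unfolding Z_def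
    using assms q_pos[THEN less_imp_le] q_sum finite_I by (auto intro!: weighted_exp_sum_bounds)
  then show "lo \<le> ln (Z u y)" "ln (Z u y) \<le> hi"
    using Z_pos[OF assms(1), of u] by (auto simp: ln_ge_iff) (metis ln_exp ln_le_cancel_iff exp_gt_zero)
qed

lemma ln_Z_integrable: "integrable M (\<lambda>y. ln (Z u y))"
proof (rule integrable_const_bound[where B = "\<Sum>i\<in>I. \<bar>u i\<bar>"])
  have b: "\<bar>u i\<bar> \<le> (\<Sum>i\<in>I. \<bar>u i\<bar>)" if "i \<in> I" for i
    using that finite_I by (intro member_le_sum) auto
  have "- (\<Sum>i\<in>I. \<bar>u i\<bar>) \<le> u i" "u i \<le> (\<Sum>i\<in>I. \<bar>u i\<bar>)" if "i \<in> I" for i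
    using b[OF that] by auto
  then have "norm (ln (Z u y)) \<le> (\<Sum>i\<in>I. \<bar>u i\<bar>)" if "y \<in> space M" for y
    using ln_Z_bounds[OF that, of "- (\<Sum>i\<in>I. \<bar>u i\<bar>)" u "\<Sum>i\<in>I. \<bar>u i\<bar>"]
    by (simp add: abs_le_iff)
  then show "AE y in M. norm (ln (Z u y)) \<le> (\<Sum>i\<in>I. \<bar>u i\<bar>)" by simp
qed simp

lemma F_cong: "(\<And>i. i \<in> I \<Longrightarrow> u i = v i) \<Longrightarrow> F u = F v"
  unfolding F_def Z_def by (simp cong: sum.cong)

text \<open>The weights \<open>w\<close> sum to 1, so the linear term moves by exactly the
  \<open>t\<close> that the logarithm gains. This is why a minimizer can be sought among vectors
  with maximum 0.\<close>

lemma F_shift: "F (\<lambda>i. u i + t) = F u"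
proof -
  have "Z (\<lambda>i. u i + t) y = exp t * Z u y" for y
    unfolding Z_def by (simp add: exp_add sum_distrib_left mult_ac)
  then have "(\<integral>y. ln (Z (\<lambda>i. u i + t) y) \<partial>M) = (\<integral>y. t + ln (Z u y) \<partial>M)"
    by (intro Bochner_Integration.integral_cong refl) (simp add: ln_mult_pos Z_pos)
  also have "\<dots> = t + (\<integral>y. ln (Z u y) \<partial>M)"
    using ln_Z_integrable by (simp add: prob_space)
  finally show ?thesis
    unfolding F_def by (simp add: distrib_left sum.distrib w_sum flip: sum_distrib_right)
qed

text \<open>One \<open>d\<close> pays for the logarithm, since \<open>Z u \<le> exp d * Z v\<close>
  pointwise, the other for the linear term, whose weights sum to 1.\<close>

lemma F_le:
  assumes "\<And>i. i \<in> I \<Longrightarrow> \<bar>u i - v i\<bar> \<le> d"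
  shows "F u \<le> F v + 2 * d"
proof -
  have "ln (Z u y) \<le> d + ln (Z v y)" if y: "y \<in> space M" for y
  proof -
    have "Z u y \<le> (\<Sum>i\<in>I. q i y * (exp d * exp (v i)))" unfolding Z_def
    proof (intro sum_mono mult_left_mono)
      fix i assume i: "i \<in> I"
      show "exp (u i) \<le> exp d * exp (v i)" using assms[OF i] by (simp flip: exp_add)
      show "0 \<le> q i y" using q_pos[OF i y] by simp
    qed
    also have "\<dots> = exp d * Z v y" by (simp add: Z_def sum_distrib_left mult_ac)
    finally have "ln (Z u y) \<le> ln (exp d * Z v y)" using Z_pos[OF y] by simp
    then show ?thesis using Z_pos[OF y] by (simp add: ln_mult_pos)
  qed
  then have "(\<integral>y. ln (Z u y) \<partial>M) \<le> (\<integral>y. d + ln (Z v y) \<partial>M)"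
    using ln_Z_integrable by (intro integral_mono) auto
  moreover have "(\<Sum>i\<in>I. w i * (v i - u i)) \<le> (\<Sum>i\<in>I. w i * d)"
  proof (intro sum_mono mult_left_mono)
    fix i assume i: "i \<in> I"
    show "v i - u i \<le> d" using assms[OF i] by simp
    show "0 \<le> w i" using w_pos[OF i] by simp
  qed
  ultimately show ?thesis unfolding F_def using ln_Z_integrable
    by (simp add: prob_space w_sum right_diff_distrib sum_subtractf flip: sum_distrib_right)
qed

lemma F_continuous: "continuous_on S F"
proof -
  have "(F \<longlongrightarrow> F u) (at u within S)" for u
  \<comment> \<open>The function space carries the product topology, so the Lipschitz bound is
    applied with the finite sum of coordinate differences, which tends to 0 because each coordinate
    does.\<close>
  proof (rule metric_tendsto_imp_tendsto[where f = "\<lambda>v. 2 * (\<Sum>i\<in>I. \<bar>v i - u i\<bar>)" and a = 0])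
    have "((\<lambda>v. v i) \<longlongrightarrow> u i) (at u within S)" for i
    proof (rule tendsto_mono[OF at_le[OF subset_UNIV]])
      have "continuous_on UNIV (\<lambda>v :: 'i \<Rightarrow> real. v i)" by simp
      then show "((\<lambda>v. v i) \<longlongrightarrow> u i) (at u within UNIV)" unfolding continuous_on_def by blast
    qed
    then have "((\<lambda>v. 2 * (\<Sum>i\<in>I. \<bar>v i - u i\<bar>)) \<longlongrightarrow> 2 * (\<Sum>i\<in>I. \<bar>u i - u i\<bar>)) (at u within S)"
      by (intro tendsto_intros)
    then show "((\<lambda>v. 2 * (\<Sum>i\<in>I. \<bar>v i - u i\<bar>)) \<longlongrightarrow> 0) (at u within S)" by simp
    have "dist (F v) (F u) \<le> 2 * (\<Sum>i\<in>I. \<bar>v i - u i\<bar>)" for v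
    proof -
      define d where "d = (\<Sum>i\<in>I. \<bar>v i - u i\<bar>)"
      have d: "\<bar>v i - u i\<bar> \<le> d" if "i \<in> I" for i
        unfolding d_def using that finite_I by (intro member_le_sum) auto
      then have "F v \<le> F u + 2 * d" by (rule F_le)
      moreover have "F u \<le> F v + 2 * d" using d by (intro F_le) (simp add: abs_minus_commute)
      ultimately show ?thesis by (simp add: dist_real_def d_def)
    qed
    moreover have "dist (2 * (\<Sum>i\<in>I. \<bar>v i - u i\<bar>)) 0 = 2 * (\<Sum>i\<in>I. \<bar>v i - u i\<bar>)" for v
      by (simp add: sum_nonneg)
    ultimately show "\<forall>\<^sub>F v in at u within S. dist (F v) (F u) \<le> dist (2 * (\<Sum>i\<in>I. \<bar>v i - u i\<bar>)) 0"
      by (intro always_eventually allI) metis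
  qed
  then show ?thesis by (simp add: continuous_on_def)
qed

text \<open>If the largest \<open>u i\<close> is 0 and the least is \<open>- R\<close>, the linear
  term contributes at least \<open>w0 * R\<close>. Where all \<open>q i\<close> are at least
  \<open>1 / (m + 1)\<close>, the logarithm is bounded below independently of \<open>R\<close>;
  elsewhere it is at least \<open>- R\<close>, but only on a set of probability below
  \<open>w0 / 2\<close>. Up to a constant, \<open>w0 * R / 2\<close> survives.\<close>

lemma F_coercive:
  obtains B where "B \<ge> 0"
    "\<And>u a b. \<lbrakk>\<And>i. i \<in> I \<Longrightarrow> u i \<le> 0; a \<in> I; u a = 0; b \<in> I; u b < - B\<rbrakk> \<Longrightarrow> F u > 0"
proof -
  define w0 where "w0 = Min (w ` I)"
  have w0: "w0 > 0" "\<And>i. i \<in> I \<Longrightarrow> w0 \<le> w i"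
    using finite_I I_ne w_pos by (auto simp: w0_def)
  \<comment> \<open>Positivity of the \<open>q i\<close> makes these sets exhaust the space, so
    their probability tends to 1.\<close>
  define Y where "Y m = {y \<in> space M. \<forall>i\<in>I. q i y \<ge> 1 / real (Suc m)}" for m :: nat
  have Y_meas [measurable]: "Y m \<in> sets M" for m
    unfolding Y_def using finite_I by measurable
  have "incseq Y"
  proof (intro incseq_SucI subsetI)
    fix m y assume "y \<in> Y m"
    moreover have "1 / real (Suc (Suc m)) \<le> 1 / real (Suc m)" by (intro frac_le) auto
    ultimately show "y \<in> Y (Suc m)" unfolding Y_def by (blast intro: order_trans)
  qed
  moreover have "(\<Union>m. Y m) = space M"
  proof (intro set_eqI iffI)
    fix y assume y: "y \<in> space M"
    define r where "r = Min ((\<lambda>i. q i y) ` I)"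
    have "r > 0" "\<And>i. i \<in> I \<Longrightarrow> r \<le> q i y"
      using finite_I I_ne q_pos y by (auto simp: r_def)
    moreover obtain m where "1 / real (Suc m) < r"
      using reals_Archimedean[OF \<open>r > 0\<close>] by (auto simp: inverse_eq_divide)
    ultimately show "y \<in> (\<Union>m. Y m)" using y by (auto simp: Y_def intro!: exI[of _ m]) fastforce
  qed (auto simp: Y_def)
  ultimately have "(\<lambda>m. measure M (Y m)) \<longlonglongrightarrow> 1"
    using finite_Lim_measure_incseq[of Y] Y_meas by (metis image_subset_iff prob_space)
  then have "\<forall>\<^sub>F m in sequentially. 1 - w0 / 2 < measure M (Y m)"
    using w0 by (intro order_tendstoD) auto
  then obtain m where m: "1 - w0 / 2 < measure M (Y m)" by (auto simp: eventually_sequentially)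
  define l where "l = ln (real (Suc m))"
  have l: "l \<ge> 0" by (simp add: l_def)
  show thesis
  proof
    \<comment> \<open>The lower bound for \<open>F u\<close> will be \<open>w0 * R / 2 - l\<close>,
      which is positive once \<open>R\<close> exceeds this constant.\<close>
    show "2 * l / w0 \<ge> 0" using l w0 by simp
    fix u a b
    assume u: "\<And>i. i \<in> I \<Longrightarrow> u i \<le> 0" and a: "a \<in> I" "u a = 0" and b: "b \<in> I" "u b < - (2 * l / w0)"
    define R where "R = - Min (u ` I)"
    have R: "- R \<le> u i" if "i \<in> I" for i
      using finite_I that by (simp add: R_def)
    have Rb: "R > 2 * l / w0" using R[OF b(1)] b(2) by linarith
    have R0: "R \<ge> 0" using R[OF a(1)] a(2) by simp
    have "- R \<in> u ` I" unfolding R_def minus_minus using finite_I I_ne by (intro Min_in) auto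
    then obtain c where c: "c \<in> I" "u c = - R" by auto
    have "- l - R * indicator (space M - Y m) y \<le> ln (Z u y)" if y: "y \<in> space M" for y
    proof (cases "y \<in> Y m")
      case True
      have "1 / real (Suc m) \<le> q a y * exp (u a)" using True a by (simp add: Y_def)
      also have "\<dots> \<le> Z u y" unfolding Z_def
        using finite_I a q_pos[THEN less_imp_le] y by (intro member_le_sum) auto
      finally have "ln (1 / real (Suc m)) \<le> ln (Z u y)" using Z_pos[OF y] by simp
      then show ?thesis using True by (simp add: l_def ln_div)
    next
      case False
      then show ?thesis using ln_Z_bounds(1)[OF y, of "-R" u 0] R u l y False by simp
    qed
    then have "(\<integral>y. - l - R * indicator (space M - Y m) y \<partial>M) \<le> (\<integral>y. ln (Z u y) \<partial>M)"
      using ln_Z_integrable by (intro integral_mono) (auto simp: emeasure_eq_measure)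
    also have "(\<integral>y. - l - R * indicator (space M - Y m) y \<partial>M) = - l - R * (1 - measure M (Y m))"
      by (simp add: prob_space prob_compl emeasure_eq_measure)
    finally have "- l - R * (1 - measure M (Y m)) \<le> (\<integral>y. ln (Z u y) \<partial>M)" .
    moreover have "R * (1 - measure M (Y m)) \<le> R * (w0 / 2)"
      using m R0 by (intro mult_left_mono) auto
    moreover have "w0 * R \<le> w c * - u c" using c w0 R0 by (simp add: mult_right_mono)
    moreover have "w c * - u c \<le> (\<Sum>i\<in>I. w i * - u i)"
      using c finite_I u w_pos[THEN less_imp_le]
      by (intro member_le_sum[of c I "\<lambda>i. w i * - u i"] mult_nonneg_nonneg) auto
    moreover have "R * w0 > 2 * l" using Rb w0 by (simp add: field_simps)
    ultimately show "F u > 0" unfolding F_def by (simp add: sum_negf algebra_simps)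
  qed
qed

lemma F_minimum: obtains u where "\<And>i. i \<in> I \<Longrightarrow> u i \<le> 0" "\<And>v. F u \<le> F v"
proof -
  obtain B where B: "B \<ge> 0"
    "\<And>u a b. \<lbrakk>\<And>i. i \<in> I \<Longrightarrow> u i \<le> 0; a \<in> I; u a = 0; b \<in> I; u b < - B\<rbrakk> \<Longrightarrow> F u > 0"
    using F_coercive by blast
  \<comment> \<open>Coordinates outside \<open>I\<close> are frozen at 0: the variables are
    functions on the whole type, and a product of compact sets over all indices is compact.\<close>
  define K where "K = (\<Pi>\<^sub>E i\<in>UNIV. if i \<in> I then {-B..0} else {0})"
  have "compact K"
    unfolding K_def compactin_euclidean_iff[symmetric] euclidean_product_topology[symmetric]
    by (subst compactin_PiE) auto
  moreover have "(\<lambda>_. 0) \<in> K" using B by (auto simp: K_def)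
  ultimately obtain u where u: "u \<in> K" "\<And>v. v \<in> K \<Longrightarrow> F u \<le> F v"
    using continuous_attains_inf[of K F] F_continuous by blast
  have "F u \<le> F v" for v
  proof -
    \<comment> \<open>Shift invariance moves the maximum to 0. If the shifted vector leaves the box,
      its value is positive, hence above the value 0 at the zero vector, which lies in the
      box.\<close>
    define t where "t = Max (v ` I)"
    define v' where "v' i = (if i \<in> I then v i - t else 0)" for i
    have Fv: "F v = F v'" using F_shift[of v "-t"] F_cong[of "\<lambda>i. v i + - t" v'] by (simp add: v'_def)
    have le: "v' i \<le> 0" for i using finite_I by (simp add: v'_def t_def)
    have "t \<in> v ` I" unfolding t_def using finite_I I_ne by (intro Max_in) auto
    then obtain a where a: "a \<in> I" "v' a = 0" by (auto simp: v'_def)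
    show ?thesis
    proof (cases "\<exists>b\<in>I. v' b < - B")
      case True
      then have "F v' > 0" using B(2) a le by blast
      moreover have "F (\<lambda>_. 0) = 0" by (simp add: F_def Z_def q_sum cong: Bochner_Integration.integral_cong)
      ultimately show ?thesis using u(2)[OF \<open>(\<lambda>_. 0) \<in> K\<close>] Fv by simp
    next
      case False
      then have "v' \<in> K" using le unfolding K_def PiE_UNIV_domain Pi_iff
        by (auto simp: not_less) (simp add: v'_def)
      then show ?thesis using u(2) Fv by simp
    qed
  qed
  moreover have "u i \<le> 0" if "i \<in> I" for i using u(1) that by (auto simp: K_def PiE_iff split: if_splits)
  ultimately show thesis using that by blast
qed

text \<open>This is the first-order condition at a minimizer. The sign of \<open>u i\<close> later
  becomes nonnegativity of the dual potential, on which the \<open>ennreal\<close> computations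
  rely.\<close>

lemma scaling_exists:
  obtains u where "\<And>i. i \<in> I \<Longrightarrow> u i \<le> 0"
    "\<And>i. i \<in> I \<Longrightarrow> (\<integral>y. q i y * exp (u i) / Z u y \<partial>M) = w i"
proof -
  obtain u where u: "\<And>i. i \<in> I \<Longrightarrow> u i \<le> 0" "\<And>v. F u \<le> F v" using F_minimum by blast
  have "(\<integral>y. q i y * exp (u i) / Z u y \<partial>M) = w i" if i: "i \<in> I" for i
  proof -
    define r where "r y = q i y * exp (u i) / Z u y" for y
    have r_meas [measurable]: "r \<in> borel_measurable M" unfolding r_def[abs_def] using i by measurable
    have r_le: "0 \<le> r y" "r y \<le> 1" if y: "y \<in> space M" for y
    proof -
      have "q i y * exp (u i) \<le> Z u y" unfolding Z_def
        using finite_I i q_pos[THEN less_imp_le] y by (intro member_le_sum) auto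
      then show "0 \<le> r y" "r y \<le> 1" unfolding r_def using Z_pos[OF y, of u] q_pos[OF i y] by (auto simp: field_simps)
    qed
    have r_int: "integrable M r"
      by (rule integrable_const_bound[where B = 1]) (use r_le in auto)
    define Q where "Q = (\<integral>y. r y \<partial>M)"
    \<comment> \<open>The bound \<open>ln x \<le> x - 1\<close> replaces differentiation under the integral sign.\<close>
    have key: "0 \<le> Q * (exp h - 1) - w i * h" for h
    proof -
      define v where "v = u(i := u i + h)"
      have "ln (Z v y) \<le> ln (Z u y) + r y * (exp h - 1)" if y: "y \<in> space M" for y
      proof -
        have "Z v y - Z u y = (\<Sum>j\<in>I. if j = i then q i y * exp (u i) * (exp h - 1) else 0)"
          unfolding Z_def v_def sum_subtractf[symmetric]
          by (intro sum.cong) (auto simp: exp_add algebra_simps)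
        also have "\<dots> = q i y * exp (u i) * (exp h - 1)" using i finite_I by simp
        finally have "(Z v y - Z u y) / Z u y = r y * (exp h - 1)" by (simp add: r_def)
        then have *: "Z v y / Z u y - 1 = r y * (exp h - 1)"
          using Z_pos[OF y, of u] by (simp add: diff_divide_distrib)
        have "ln (Z v y) - ln (Z u y) = ln (Z v y / Z u y)"
          using Z_pos[OF y, of u] Z_pos[OF y, of v] by (simp add: ln_div)
        also have "\<dots> \<le> Z v y / Z u y - 1" using Z_pos[OF y, of u] Z_pos[OF y, of v] by (intro ln_le_minus_one) simp
        finally show ?thesis using * by simp
      qed
      then have "(\<integral>y. ln (Z v y) \<partial>M) \<le> (\<integral>y. ln (Z u y) + r y * (exp h - 1) \<partial>M)"
        using ln_Z_integrable r_int by (intro integral_mono) auto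
      also have "\<dots> = (\<integral>y. ln (Z u y) \<partial>M) + Q * (exp h - 1)"
        using ln_Z_integrable r_int by (simp add: Q_def)
      finally have "(\<integral>y. ln (Z v y) \<partial>M) \<le> (\<integral>y. ln (Z u y) \<partial>M) + Q * (exp h - 1)" .
      moreover have "(\<Sum>j\<in>I. w j * v j) - (\<Sum>j\<in>I. w j * u j) = (\<Sum>j\<in>I. if j = i then w i * h else 0)"
        unfolding v_def sum_subtractf[symmetric] by (intro sum.cong) (auto simp: algebra_simps)
      moreover have "(\<Sum>j\<in>I. if j = i then w i * h else 0) = w i * h" using i finite_I by simp
      ultimately show ?thesis using u(2)[of v] unfolding F_def by linarith
    qed
    \<comment> \<open>The expression in \<open>key\<close> vanishes at \<open>h = 0\<close> and is
      never negative, so its derivative \<open>Q - w i\<close> at 0 is zero.\<close>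
    have "((\<lambda>h. Q * (exp h - 1) - w i * h) has_real_derivative Q * exp 0 - w i) (at 0)"
      by (auto intro!: derivative_eq_intros)
    from DERIV_local_min[OF this zero_less_one] key have "Q * exp 0 - w i = 0" by simp
    then show ?thesis by (simp add: Q_def r_def)
  qed
  with u(1) show thesis using that by blast
qed

end

lemma scaling_vector_exists:
  fixes q :: "'i \<Rightarrow> 'a \<Rightarrow> real"
  assumes "prob_space M" "finite I" "I \<noteq> {}" "\<And>i. i \<in> I \<Longrightarrow> q i \<in> borel_measurable M"
    "\<And>i y. i \<in> I \<Longrightarrow> y \<in> space M \<Longrightarrow> q i y > 0" "\<And>y. y \<in> space M \<Longrightarrow> (\<Sum>i\<in>I. q i y) = 1"
    "\<And>i. i \<in> I \<Longrightarrow> w i > 0" "(\<Sum>i\<in>I. w i) = 1"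
  obtains u where "\<And>i. i \<in> I \<Longrightarrow> u i \<le> 0"
    "\<And>i. i \<in> I \<Longrightarrow> (\<integral>y. q i y * exp (u i) / (\<Sum>j\<in>I. q j y * exp (u j)) \<partial>M) = w i"
proof -
  interpret scaling_problem M I q w
    using assms by (simp add: scaling_problem_def scaling_problem_axioms_def)
  show thesis using scaling_exists that unfolding Z_def by blast
qed

section \<open>Semidiscrete transport\<close>

text \<open>An index with \<open>a i > a j\<close> has weight at most \<open>exp (- t)\<close> for
  \<open>t = (a i - a j) / \<eta>\<close>, so its excess contributes at most
  \<open>\<eta> * t * exp (- t) \<le> \<eta>\<close>. The other indices contribute no
  excess.\<close>

lemma softmin_weights_bound:
  fixes a :: "'i \<Rightarrow> real"
  assumes "finite I" "j \<in> I" "\<eta> > 0"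
  shows "(\<Sum>i\<in>I. exp (- a i / \<eta>) / (\<Sum>l\<in>I. exp (- a l / \<eta>)) * a i) \<le> a j + real (card I) * \<eta>"
proof -
  define Z where "Z = (\<Sum>l\<in>I. exp (- a l / \<eta>))"
  have Zj: "exp (- a j / \<eta>) \<le> Z" unfolding Z_def using assms by (intro member_le_sum) auto
  then have Zp: "Z > 0" by (meson exp_gt_zero less_le_trans)
  have "exp (- a i / \<eta>) / Z * (a i - a j) \<le> \<eta>" for i
  proof (cases "a i \<ge> a j")
    case True
    define t where "t = (a i - a j) / \<eta>"
    have t: "t \<ge> 0" using True assms by (simp add: t_def)
    have "exp (- a i / \<eta>) / Z \<le> exp (- a i / \<eta>) / exp (- a j / \<eta>)"
      using Zj Zp by (intro divide_left_mono) auto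
    also have "\<dots> = exp (- t)" by (simp add: t_def diff_divide_distrib flip: exp_diff)
    finally have "exp (- a i / \<eta>) / Z * (a i - a j) \<le> exp (- t) * (a i - a j)"
      using True by (intro mult_right_mono) auto
    also have "\<dots> = \<eta> * (exp (- t) * t)" using assms by (simp add: t_def)
    also have "\<dots> \<le> \<eta> * 1"
    proof (intro mult_left_mono)
      have "t \<le> exp t" using exp_ge_add_one_self[of t] by linarith
      then show "exp (- t) * t \<le> 1" by (simp add: exp_minus field_simps)
    qed (use assms in simp)
    finally show ?thesis by simp
  next
    case False
    then have "exp (- a i / \<eta>) / Z * (a i - a j) \<le> 0" using Zp by (intro mult_nonneg_nonpos) auto
    then show ?thesis using assms by simp
  qed
  then have "(\<Sum>i\<in>I. exp (- a i / \<eta>) / Z * (a i - a j)) \<le> (\<Sum>i\<in>I. \<eta>)" by (intro sum_mono)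
  moreover have "(\<Sum>i\<in>I. exp (- a i / \<eta>) / Z) = 1"
    using Zp by (simp add: Z_def flip: sum_divide_distrib)
  ultimately show ?thesis
    unfolding Z_def[symmetric] right_diff_distrib sum_subtractf sum_distrib_right[symmetric] by simp
qed

text \<open>Think of \<open>f i y\<close> as the conditional probability of the index
  \<open>i\<close> given \<open>y\<close>: the integrals are the marginal constraint on the index,
  and the last property is approximate complementary slackness.\<close>

lemma transport_weights_exist:
  fixes c :: "'i \<Rightarrow> 'a \<Rightarrow> real"
  assumes M: "prob_space M" and I: "finite I" "I \<noteq> {}"
    and c [measurable]: "\<And>i. i \<in> I \<Longrightarrow> c i \<in> borel_measurable M"
    and w: "\<And>i. i \<in> I \<Longrightarrow> w i > 0" "(\<Sum>i\<in>I. w i) = 1" and \<epsilon>: "\<epsilon> > 0"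
  obtains \<psi> f where "\<And>i. i \<in> I \<Longrightarrow> \<psi> i \<ge> 0"
    "\<And>i. i \<in> I \<Longrightarrow> f i \<in> borel_measurable M" "\<And>i y. f i y \<ge> 0" "\<And>y. (\<Sum>i\<in>I. f i y) = 1"
    "\<And>i. i \<in> I \<Longrightarrow> (\<integral>y. f i y \<partial>M) = w i"
    "\<And>y j. j \<in> I \<Longrightarrow> (\<Sum>i\<in>I. f i y * (c i y + \<psi> i)) \<le> c j y + \<psi> j + \<epsilon>"
proof -
  \<comment> \<open>This temperature makes the softmin error \<open>card I * \<eta>\<close> equal to
    \<open>\<epsilon>\<close>.\<close>
  define \<eta> where "\<eta> = \<epsilon> / real (card I)"
  have \<eta>: "\<eta> > 0" "real (card I) * \<eta> = \<epsilon>" using I \<epsilon> by (auto simp: \<eta>_def card_gt_0_iff)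
  define Z where "Z y = (\<Sum>l\<in>I. exp (- c l y / \<eta>))" for y
  have Zp: "Z y > 0" for y unfolding Z_def using I by (intro sum_pos) auto
  define q where "q i y = exp (- c i y / \<eta>) / Z y" for i y
  have q_sum: "(\<Sum>i\<in>I. q i y) = 1" for y
    using Zp[of y] by (simp add: q_def Z_def flip: sum_divide_distrib)
  have [measurable]: "q i \<in> borel_measurable M" if "i \<in> I" for i
    using that unfolding q_def[abs_def] Z_def[abs_def] by measurable
  obtain u where u: "\<And>i. i \<in> I \<Longrightarrow> u i \<le> 0"
    "\<And>i. i \<in> I \<Longrightarrow> (\<integral>y. q i y * exp (u i) / (\<Sum>j\<in>I. q j y * exp (u j)) \<partial>M) = w i"
    using scaling_vector_exists[OF M I, of q w] w q_sum Zp by (auto simp: q_def)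
  define \<psi> where "\<psi> i = - \<eta> * u i" for i
  define f where "f i y = q i y * exp (u i) / (\<Sum>j\<in>I. q j y * exp (u j))" for i y
  \<comment> \<open>The factor \<open>Z y\<close> cancels, so \<open>f\<close> is the softmin of
    \<open>c + \<psi>\<close> at temperature \<open>\<eta>\<close> and the normalization of
    \<open>q\<close> leaves no trace.\<close>
  have f_alt: "f i y = exp (- (c i y + \<psi> i) / \<eta>) / (\<Sum>l\<in>I. exp (- (c l y + \<psi> l) / \<eta>))" for i y
  proof -
    have "exp (- (c i y + \<psi> i) / \<eta>) = Z y * (q i y * exp (u i))" for i
    proof -
      have e: "- (c i y + \<psi> i) / \<eta> = - c i y / \<eta> + u i" using \<eta>(1) by (simp add: \<psi>_def field_simps)
      show ?thesis unfolding e exp_add using Zp[of y] by (simp add: q_def)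
    qed
    then show ?thesis unfolding f_def using Zp[of y] by (simp flip: sum_distrib_left)
  qed
  show thesis
  proof
    show "\<psi> i \<ge> 0" if "i \<in> I" for i using u(1)[OF that] \<eta> by (simp add: \<psi>_def mult_nonneg_nonpos)
    show "f i \<in> borel_measurable M" if "i \<in> I" for i
      using that unfolding f_def[abs_def] by measurable
    show "f i y \<ge> 0" for i y unfolding f_alt by (intro divide_nonneg_nonneg sum_nonneg) auto
    have "(\<Sum>l\<in>I. exp (- (c l y + \<psi> l) / \<eta>)) > 0" for y using I by (intro sum_pos) auto
    then show "(\<Sum>i\<in>I. f i y) = 1" for y
      unfolding f_alt by (simp flip: sum_divide_distrib) (metis less_irrefl)
    show "(\<integral>y. f i y \<partial>M) = w i" if "i \<in> I" for i using u(2)[OF that] by (simp add: f_def)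
    show "(\<Sum>i\<in>I. f i y * (c i y + \<psi> i)) \<le> c j y + \<psi> j + \<epsilon>" if "j \<in> I" for j y
      using softmin_weights_bound[OF I(1) that \<eta>(1), of "\<lambda>i. c i y + \<psi> i"]
      unfolding f_alt \<eta>(2) .
  qed
qed

section \<open>Couplings with an empirical marginal, and duality\<close>

lemma couplingsD:
  assumes "\<pi> \<in> couplings \<mu> \<nu>"
  shows "prob_space \<pi>" "sets \<pi> = sets (borel \<Otimes>\<^sub>M borel)" "distr \<pi> borel fst = \<mu>" "distr \<pi> borel snd = \<nu>"
  using assms by (auto simp: couplings_def space_prob_algebra)

lemma couplings_measurable:
  assumes "\<pi> \<in> couplings \<mu> \<nu>"
  shows "measurable \<pi> N = measurable (borel \<Otimes>\<^sub>M borel) N"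
  using couplingsD(2)[OF assms] by (rule measurable_cong_sets) simp

lemma nn_integral_coupling_fst:
  assumes "\<pi> \<in> couplings \<mu> \<nu>" "g \<in> borel_measurable borel"
  shows "(\<integral>\<^sup>+z. g (fst z) \<partial>\<pi>) = (\<integral>\<^sup>+x. g x \<partial>\<mu>)"
  unfolding couplingsD(3)[OF assms(1), symmetric] using assms
  by (subst nn_integral_distr) (auto simp: couplings_measurable[OF assms(1)])

lemma nn_integral_coupling_snd:
  assumes "\<pi> \<in> couplings \<mu> \<nu>" "g \<in> borel_measurable borel"
  shows "(\<integral>\<^sup>+z. g (snd z) \<partial>\<pi>) = (\<integral>\<^sup>+x. g x \<partial>\<nu>)"
  unfolding couplingsD(4)[OF assms(1), symmetric] using assms
  by (subst nn_integral_distr) (auto simp: couplings_measurable[OF assms(1)])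

lemma nn_integral_empirical_measure:
  assumes "g \<in> borel_measurable borel"
  shows "(\<integral>\<^sup>+x. g x \<partial>empirical_measure n x) = (\<Sum>i=1..n. g (x i)) / of_nat n"
proof (cases "n = 0")
  \<comment> \<open>The null measure on the left meets \<open>0 / 0 = 0\<close> on the
    right.\<close>
  case True
  then show ?thesis using assms unfolding empirical_measure_def uniform_count_measure_def
    by (subst nn_integral_distr) (auto simp: nn_integral_point_measure_finite measurable_point_measure_eq1)
next
  case False
  have "(\<integral>\<^sup>+x. g x \<partial>empirical_measure n x) = (\<Sum>i=1..n. ennreal (1 / real n) * g (x i))"
    using assms unfolding empirical_measure_def uniform_count_measure_def
    by (subst nn_integral_distr) (auto simp: nn_integral_point_measure_finite measurable_point_measure_eq1)
  also have "\<dots> = (\<Sum>i=1..n. g (x i)) / of_nat n"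
    using False by (simp add: ennreal_of_nat_eq_real_of_nat divide_ennreal_def inverse_ennreal
        inverse_eq_divide mult.commute[of _ "ennreal (1 / real n)"] flip: sum_distrib_left)
  finally show ?thesis .
qed

lemma prob_space_empirical_measure:
  assumes "n > 0" shows "empirical_measure n x \<in> space (prob_algebra borel)"
  unfolding empirical_measure_def space_prob_algebra uniform_count_measure_def
  using assms prob_space_uniform_count_measure[of "{1..n}"]
  by (auto intro!: prob_space.prob_space_distr simp: uniform_count_measure_def measurable_point_measure_eq1)

text \<open>The coupling is the law of \<open>(x i, y)\<close> when \<open>y\<close> has law
  \<open>\<mu>\<close> and \<open>i\<close> is then drawn with probabilities \<open>f i y\<close>.
  Building it on indices instead of points lets repeated sample points keep separate
  weights.\<close>

lemma coupling_of_weights: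
  fixes x :: "nat \<Rightarrow> 'a::euclidean_space"
  assumes \<mu>: "\<mu> \<in> space (prob_algebra borel)" and n: "n > 0"
    and f [measurable]: "\<And>i. i \<in> {1..n} \<Longrightarrow> f i \<in> borel_measurable borel"
    and f_nonneg: "\<And>i y. f i y \<ge> 0" and f_sum: "\<And>y. (\<Sum>i=1..n. f i y) = 1"
    and f_int: "\<And>i. i \<in> {1..n} \<Longrightarrow> (\<integral>y. f i y \<partial>\<mu>) = 1 / real n"
  obtains \<pi> where "\<pi> \<in> couplings (empirical_measure n x) \<mu>"
    "\<And>g. g \<in> borel_measurable (borel \<Otimes>\<^sub>M borel) \<Longrightarrow>
       (\<integral>\<^sup>+z. g z \<partial>\<pi>) = (\<integral>\<^sup>+y. (\<Sum>i=1..n. ennreal (f i y) * g (x i, y)) \<partial>\<mu>)"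
proof -
  interpret prob_space \<mu> using \<mu> by (simp add: space_prob_algebra)
  have sets_mu [measurable_cong, simp]: "sets \<mu> = sets borel" using \<mu> by (simp add: space_prob_algebra)
  have f_le: "f i y \<le> 1" if "i \<in> {1..n}" for i y
    using member_le_sum[OF that, of "\<lambda>i. f i y"] f_nonneg f_sum[of y] by auto
  define C where "C = count_space {1..n}"
  interpret C: sigma_finite_measure C unfolding C_def by (rule sigma_finite_measure_count_space)
  interpret P: pair_sigma_finite C \<mu> ..
  define F where "F z = ennreal (f (fst z) (snd z))" for z
  have F_meas [measurable]: "F \<in> borel_measurable (C \<Otimes>\<^sub>M \<mu>)"
    unfolding C_def F_def[abs_def] by (rule measurable_pair_measure_countable1) auto
  have x_meas [measurable]: "x \<in> measurable C borel" unfolding C_def by simp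
  define T where "T z = (x (fst z), snd z)" for z :: "nat \<times> 'a"
  have T_meas [measurable]: "T \<in> measurable (C \<Otimes>\<^sub>M \<mu>) (borel \<Otimes>\<^sub>M borel)"
    unfolding T_def[abs_def] by measurable
  define \<pi> where "\<pi> = distr (density (C \<Otimes>\<^sub>M \<mu>) F) (borel \<Otimes>\<^sub>M borel) T"
  have int: "(\<integral>\<^sup>+z. g z \<partial>\<pi>) = (\<integral>\<^sup>+y. (\<Sum>i=1..n. ennreal (f i y) * g (x i, y)) \<partial>\<mu>)"
    if g [measurable]: "g \<in> borel_measurable (borel \<Otimes>\<^sub>M borel)" for g
  proof -
    have "(\<integral>\<^sup>+z. g z \<partial>\<pi>) = (\<integral>\<^sup>+z. F z * g (T z) \<partial>(C \<Otimes>\<^sub>M \<mu>))"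
      unfolding \<pi>_def by (subst nn_integral_distr) (auto simp: nn_integral_density)
    also have "\<dots> = (\<integral>\<^sup>+y. (\<integral>\<^sup>+i. F (i, y) * g (T (i, y)) \<partial>C) \<partial>\<mu>)"
      by (rule P.nn_integral_snd[symmetric]) measurable
    also have "\<dots> = (\<integral>\<^sup>+y. (\<Sum>i=1..n. ennreal (f i y) * g (x i, y)) \<partial>\<mu>)"
      by (simp add: C_def nn_integral_count_space_finite F_def T_def)
    finally show ?thesis .
  qed
  have sets_pi: "sets \<pi> = sets (borel \<Otimes>\<^sub>M borel)" by (simp add: \<pi>_def)
  have f_emeasure: "(\<integral>\<^sup>+y. ennreal (f i y) \<partial>\<mu>) = 1 / of_nat n" if i: "i \<in> {1..n}" for i
  proof -
    have "integrable \<mu> (f i)"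
      using i f_nonneg f_le by (intro integrable_const_bound[where B = 1]) auto
    then have "(\<integral>\<^sup>+y. ennreal (f i y) \<partial>\<mu>) = ennreal (1 / real n)"
      using f_int[OF i] f_nonneg by (simp add: nn_integral_eq_integral)
    also have "\<dots> = 1 / of_nat n"
      using n by (simp add: ennreal_of_nat_eq_real_of_nat divide_ennreal[symmetric])
    finally show ?thesis .
  qed
  have fst_distr: "distr \<pi> borel fst = empirical_measure n x"
  proof (rule measure_eqI)
    fix A assume "A \<in> sets (distr \<pi> borel fst)"
    then have A [measurable]: "A \<in> sets borel" by simp
    have "emeasure (distr \<pi> borel fst) A = (\<integral>\<^sup>+z. indicator A (fst z) \<partial>\<pi>)"
      using A sets_pi by (subst nn_integral_indicator[symmetric], simp, subst nn_integral_distr)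
        (auto cong: measurable_cong_sets)
    also have "\<dots> = (\<integral>\<^sup>+y. (\<Sum>i=1..n. ennreal (f i y) * indicator A (x i)) \<partial>\<mu>)"
      using int[of "\<lambda>z. indicator A (fst z)"] by simp
    also have "\<dots> = (\<Sum>i=1..n. (\<integral>\<^sup>+y. ennreal (f i y) \<partial>\<mu>) * indicator A (x i))"
      by (subst nn_integral_sum) (simp_all add: nn_integral_multc)
    also have "\<dots> = (\<Sum>i=1..n. indicator A (x i) / of_nat n)"
      by (intro sum.cong refl) (simp only: f_emeasure divide_ennreal_def mult.commute mult_1_left mult_1_right)
    also have "\<dots> = emeasure (empirical_measure n x) A"
      using A by (simp add: emeasure_empirical_measure divide_ennreal_def sum_distrib_right)
    finally show "emeasure (distr \<pi> borel fst) A = emeasure (empirical_measure n x) A" .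
  qed (simp add: empirical_measure_def)
  have snd_distr: "distr \<pi> borel snd = \<mu>"
  proof (rule measure_eqI)
    fix A assume "A \<in> sets (distr \<pi> borel snd)"
    then have A [measurable]: "A \<in> sets borel" by simp
    have "emeasure (distr \<pi> borel snd) A = (\<integral>\<^sup>+z. indicator A (snd z) \<partial>\<pi>)"
      using A sets_pi by (subst nn_integral_indicator[symmetric], simp, subst nn_integral_distr)
        (auto cong: measurable_cong_sets)
    also have "\<dots> = (\<integral>\<^sup>+y. (\<Sum>i=1..n. ennreal (f i y)) * indicator A y \<partial>\<mu>)"
      using int[of "\<lambda>z. indicator A (snd z)"] by (simp add: sum_distrib_right)
    also have "\<dots> = (\<integral>\<^sup>+y. indicator A y \<partial>\<mu>)"
      using f_nonneg f_sum by (simp add: sum_ennreal)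
    finally show "emeasure (distr \<pi> borel snd) A = emeasure \<mu> A" by simp
  qed simp
  have "prob_space \<pi>"
  proof
    have "emeasure \<pi> (space \<pi>) = emeasure (distr \<pi> borel snd) UNIV"
      using sets_pi by (subst emeasure_distr) (auto cong: measurable_cong_sets)
    then show "emeasure \<pi> (space \<pi>) = 1"
      unfolding snd_distr using emeasure_space_1 sets_eq_imp_space_eq[OF sets_mu] by simp
  qed
  then have "\<pi> \<in> couplings (empirical_measure n x) \<mu>"
    using sets_pi fst_distr snd_distr by (simp add: couplings_def space_prob_algebra)
  with int show thesis using that by blast
qed

text \<open>
  Strong duality, up to \<open>\<epsilon>\<close>, for transport from finitely many points: the potential \<open>\<psi>\<close> comes with a
  coupling, and no integrability of the cost is needed.
\<close>

lemma semidiscrete_duality: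
  fixes c :: "'a::euclidean_space \<times> 'a \<Rightarrow> real"
  assumes \<mu>: "\<mu> \<in> space (prob_algebra borel)" and n: "n > 0"
    and c [measurable]: "c \<in> borel_measurable (borel \<Otimes>\<^sub>M borel)" and c_nonneg: "\<And>z. c z \<ge> 0"
    and \<epsilon>: "\<epsilon> > 0"
  obtains \<psi> \<pi> where "\<And>i. i \<in> {1..n} \<Longrightarrow> \<psi> i \<ge> 0" "\<pi> \<in> couplings (empirical_measure n x) \<mu>"
    "(\<integral>\<^sup>+z. ennreal (c z) \<partial>\<pi>) + ennreal ((\<Sum>i=1..n. \<psi> i) / real n)
       \<le> (\<integral>\<^sup>+y. ennreal (Min ((\<lambda>i. c (x i, y) + \<psi> i) ` {1..n})) \<partial>\<mu>) + ennreal \<epsilon>"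
proof -
  interpret prob_space \<mu> using \<mu> by (simp add: space_prob_algebra)
  have sets_mu [measurable_cong, simp]: "sets \<mu> = sets borel" using \<mu> by (simp add: space_prob_algebra)
  obtain \<psi> f where \<psi>: "\<And>i. i \<in> {1..n} \<Longrightarrow> \<psi> i \<ge> 0"
    and f: "\<And>i. i \<in> {1..n} \<Longrightarrow> f i \<in> borel_measurable \<mu>" "\<And>i y. f i y \<ge> 0"
      "\<And>y. (\<Sum>i=1..n. f i y) = 1" "\<And>i. i \<in> {1..n} \<Longrightarrow> (\<integral>y. f i y \<partial>\<mu>) = 1 / real n"
    and le: "\<And>y j. j \<in> {1..n} \<Longrightarrow> (\<Sum>i=1..n. f i y * (c (x i, y) + \<psi> i)) \<le> c (x j, y) + \<psi> j + \<epsilon>"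
    using transport_weights_exist[OF prob_space_axioms, of "{1..n}" "\<lambda>i y. c (x i, y)" "\<lambda>_. 1 / real n" \<epsilon>] n \<epsilon>
    by auto
  have f_meas [measurable]: "f i \<in> borel_measurable borel" if "i \<in> {1..n}" for i
    using f(1)[OF that] by simp
  obtain \<pi> where \<pi>: "\<pi> \<in> couplings (empirical_measure n x) \<mu>"
    and int: "\<And>g. g \<in> borel_measurable (borel \<Otimes>\<^sub>M borel) \<Longrightarrow>
       (\<integral>\<^sup>+z. g z \<partial>\<pi>) = (\<integral>\<^sup>+y. (\<Sum>i=1..n. ennreal (f i y) * g (x i, y)) \<partial>\<mu>)"
    using coupling_of_weights[OF \<mu> n f_meas f(2-4)] by blast
  \<comment> \<open>A non-integrable function has Bochner integral 0, whereas this integral is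
    \<open>1 / n\<close>.\<close>
  have f_int: "integrable \<mu> (f i)" if "i \<in> {1..n}" for i
    using f(4)[OF that] n not_integrable_integral_eq by fastforce
  \<comment> \<open>By the marginal constraint the mean of the potential is an integral against
    \<open>\<mu>\<close>. Cost and potential can then be merged under one integral, where the
    pointwise bound applies.\<close>
  have "ennreal ((\<Sum>i=1..n. \<psi> i) / real n) = ennreal (\<integral>y. (\<Sum>i=1..n. f i y * \<psi> i) \<partial>\<mu>)"
    using f_int f(4) by (subst Bochner_Integration.integral_sum) (auto simp: sum_divide_distrib intro!: arg_cong[where f = ennreal] sum.cong)
  also have "\<dots> = (\<integral>\<^sup>+y. ennreal (\<Sum>i=1..n. f i y * \<psi> i) \<partial>\<mu>)"
    using f_int f(2) \<psi> by (intro nn_integral_eq_integral[symmetric]) (auto intro!: sum_nonneg)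
  finally have avg: "ennreal ((\<Sum>i=1..n. \<psi> i) / real n) = (\<integral>\<^sup>+y. ennreal (\<Sum>i=1..n. f i y * \<psi> i) \<partial>\<mu>)" .
  have "(\<integral>\<^sup>+z. ennreal (c z) \<partial>\<pi>) = (\<integral>\<^sup>+y. ennreal (\<Sum>i=1..n. f i y * c (x i, y)) \<partial>\<mu>)"
    using f(2) c_nonneg by (subst int) (auto simp: ennreal_mult sum_nonneg simp flip: sum_ennreal)
  then have "(\<integral>\<^sup>+z. ennreal (c z) \<partial>\<pi>) + ennreal ((\<Sum>i=1..n. \<psi> i) / real n)
      = (\<integral>\<^sup>+y. ennreal (\<Sum>i=1..n. f i y * c (x i, y)) + ennreal (\<Sum>i=1..n. f i y * \<psi> i) \<partial>\<mu>)"
    unfolding avg by (subst nn_integral_add) auto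
  also have "\<dots> = (\<integral>\<^sup>+y. ennreal (\<Sum>i=1..n. f i y * (c (x i, y) + \<psi> i)) \<partial>\<mu>)"
    using f(2) c_nonneg \<psi>
    by (intro nn_integral_cong, subst ennreal_plus[symmetric])
       (auto simp: distrib_left sum.distrib intro!: sum_nonneg)
  also have "\<dots> \<le> (\<integral>\<^sup>+y. ennreal (Min ((\<lambda>i. c (x i, y) + \<psi> i) ` {1..n})) + ennreal \<epsilon> \<partial>\<mu>)"
  proof (intro nn_integral_mono)
    fix y
    define m where "m = Min ((\<lambda>i. c (x i, y) + \<psi> i) ` {1..n})"
    have "m \<in> (\<lambda>i. c (x i, y) + \<psi> i) ` {1..n}" unfolding m_def using n by (intro Min_in) auto
    then obtain j where "j \<in> {1..n}" "m = c (x j, y) + \<psi> j" by auto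
    then have "(\<Sum>i=1..n. f i y * (c (x i, y) + \<psi> i)) \<le> m + \<epsilon>" "m \<ge> 0" using le \<psi> c_nonneg by auto
    then show "ennreal (\<Sum>i=1..n. f i y * (c (x i, y) + \<psi> i)) \<le> ennreal m + ennreal \<epsilon>"
      using \<epsilon> by (simp flip: ennreal_plus)
  qed
  also have "\<dots> = (\<integral>\<^sup>+y. ennreal (Min ((\<lambda>i. c (x i, y) + \<psi> i) ` {1..n})) \<partial>\<mu>) + ennreal \<epsilon>"
    by (subst nn_integral_add) (auto simp: emeasure_space_1)
  finally show thesis using that \<psi> \<pi> by blast
qed

lemma AE_empirical_measure:
  fixes x :: "nat \<Rightarrow> 'a::t1_space"
  shows "AE s in empirical_measure n x. s \<in> x ` {1..n}"
  unfolding empirical_measure_def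
  by (subst AE_distr_iff) (auto simp: uniform_count_measure_def measurable_point_measure_eq1 space_point_measure
      intro!: finite_imp_closed borel_closed AE_I2)

text \<open>A coupling sees a point but not its index, and coinciding points may carry different
  values of \<open>\<psi>\<close>. The bound on \<open>h\<close> holds for every index, so the least
  value at each point may be used, which can only lower the mean of the potential. The bound is then
  integrated along the coupling.\<close>

lemma semidiscrete_weak_duality:
  fixes c :: "'a::euclidean_space \<times> 'a \<Rightarrow> ennreal"
  assumes \<pi>: "\<pi> \<in> couplings (empirical_measure n x) \<nu>" and n: "n > 0"
    and c [measurable]: "c \<in> borel_measurable (borel \<Otimes>\<^sub>M borel)"
    and h [measurable]: "h \<in> borel_measurable borel"
    and \<psi>: "\<And>i. i \<in> {1..n} \<Longrightarrow> \<psi> i \<ge> 0"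
    and le: "\<And>i y. i \<in> {1..n} \<Longrightarrow> h y \<le> c (x i, y) + ennreal (\<psi> i)"
  shows "(\<integral>\<^sup>+y. h y \<partial>\<nu>) \<le> (\<integral>\<^sup>+z. c z \<partial>\<pi>) + ennreal ((\<Sum>i=1..n. \<psi> i) / real n)"
proof -
  define S where "S = x ` {1..n}"
  define m where "m s = Min (\<psi> ` {i \<in> {1..n}. x i = s})" for s
  have m: "m (x i) \<le> \<psi> i" if "i \<in> {1..n}" for i
    unfolding m_def using that by (intro Min_le) auto
  have m_in: "m s \<in> \<psi> ` {i \<in> {1..n}. x i = s}" if "s \<in> S" for s
    unfolding m_def using that by (intro Min_in) (auto simp: S_def)
  \<comment> \<open>The sum runs over distinct points and is Borel measurable. Its value 0 off the
    sample is harmless, because the first coordinate lies in the sample almost surely.\<close>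
  define \<phi> where "\<phi> y = (\<Sum>s\<in>S. ennreal (m s) * indicator {s} y)" for y
  have [measurable]: "\<phi> \<in> borel_measurable borel" unfolding \<phi>_def[abs_def] by measurable
  have \<phi>: "\<phi> s = ennreal (m s)" if "s \<in> S" for s
  proof -
    have "\<phi> s = (\<Sum>t\<in>S. if t = s then ennreal (m s) else 0)"
      unfolding \<phi>_def by (intro sum.cong) (auto simp: indicator_def)
    then show ?thesis using that by (simp add: S_def)
  qed
  have "AE s in empirical_measure n x. s \<in> S"
    unfolding S_def by (rule AE_empirical_measure)
  then have "AE z in \<pi>. fst z \<in> S"
    unfolding couplingsD(3)[OF \<pi>, symmetric]
    by (subst (asm) AE_distr_iff) (auto simp: couplings_measurable[OF \<pi>] S_def
         intro!: finite_imp_closed borel_closed)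
  then have "AE z in \<pi>. h (snd z) \<le> c z + \<phi> (fst z)"
  proof eventually_elim
    case (elim z)
    from m_in[OF this] obtain i where "i \<in> {1..n}" "x i = fst z" "m (fst z) = \<psi> i" by auto
    then show ?case using le[of i "snd z"] \<phi>[OF elim] by simp
  qed
  then have "(\<integral>\<^sup>+z. h (snd z) \<partial>\<pi>) \<le> (\<integral>\<^sup>+z. c z + \<phi> (fst z) \<partial>\<pi>)" by (rule nn_integral_mono_AE)
  also have "\<dots> = (\<integral>\<^sup>+z. c z \<partial>\<pi>) + (\<integral>\<^sup>+z. \<phi> (fst z) \<partial>\<pi>)"
    by (intro nn_integral_add) (auto simp: couplings_measurable[OF \<pi>])
  also have "(\<integral>\<^sup>+z. \<phi> (fst z) \<partial>\<pi>) = (\<Sum>i=1..n. \<phi> (x i)) / of_nat n"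
    by (simp add: nn_integral_coupling_fst[OF \<pi>] nn_integral_empirical_measure)
  also have "\<dots> \<le> (\<Sum>i=1..n. ennreal (\<psi> i)) / of_nat n"
    by (intro divide_right_mono_ennreal sum_mono) (auto simp: \<phi> S_def intro!: ennreal_leI m)
  also have "\<dots> = ennreal ((\<Sum>i=1..n. \<psi> i) / real n)"
    using \<psi> n sum_nonneg[of "{1..n}" \<psi>] sum_ennreal[of "{1..n}" \<psi>]
    by (simp add: ennreal_of_nat_eq_real_of_nat divide_ennreal)
  finally show ?thesis by (simp add: nn_integral_coupling_snd[OF \<pi>] add_left_mono)
qed

section \<open>Triangle inequality with an empirical measure\<close>

lemma emeasure_empirical_singleton_nonzero:
  fixes x :: "nat \<Rightarrow> 'a::t1_space"
  assumes "s \<in> x ` {1..n}" shows "emeasure (empirical_measure n x) {s} \<noteq> 0"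
proof -
  from assms obtain j where j: "j \<in> {1..n}" "x j = s" by auto
  have "(\<Sum>i=1..n. emeasure (return borel (x i)) {s}) \<ge> emeasure (return borel (x j)) {s}"
    using j by (intro member_le_sum) auto
  moreover have "emeasure (return borel (x j)) {s} = 1" using j by simp
  ultimately have "(\<Sum>i=1..n. emeasure (return borel (x i)) {s}) \<noteq> 0" by (metis not_one_le_zero)
  then show ?thesis
    by (auto simp: emeasure_empirical_measure ennreal_divide_eq_0_iff)
qed

text \<open>Over a finitely supported middle law, gluing amounts to conditioning on an atom. The law
  of all four coordinates stays inside the proof; only the coupling of the outer two and the
  integrated cost inequality are exported.\<close>

lemma glue_couplings:
  fixes y :: "nat \<Rightarrow> 'a::euclidean_space"
  assumes n: "n > 0" and \<gamma>: "\<gamma>1 \<in> couplings \<mu> (empirical_measure n y)"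
    "\<gamma>2 \<in> couplings (empirical_measure n y) \<nu>"
  obtains \<gamma> where "\<gamma> \<in> couplings \<mu> \<nu>"
    "\<And>C C1 C2 :: 'a \<times> 'a \<Rightarrow> ennreal. \<lbrakk>C \<in> borel_measurable (borel \<Otimes>\<^sub>M borel);
       C1 \<in> borel_measurable (borel \<Otimes>\<^sub>M borel); C2 \<in> borel_measurable (borel \<Otimes>\<^sub>M borel);
       \<And>x y z. C (x, z) \<le> C1 (x, y) + C2 (y, z)\<rbrakk>
      \<Longrightarrow> (\<integral>\<^sup>+z. C z \<partial>\<gamma>) \<le> (\<integral>\<^sup>+z. C1 z \<partial>\<gamma>1) + (\<integral>\<^sup>+z. C2 z \<partial>\<gamma>2)"
proof -
  let ?B = "borel \<Otimes>\<^sub>M borel :: ('a \<times> 'a) measure"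
  interpret g1: prob_space \<gamma>1 using couplingsD(1)[OF \<gamma>(1)] .
  interpret g2: prob_space \<gamma>2 using couplingsD(1)[OF \<gamma>(2)] .
  interpret P: pair_sigma_finite \<gamma>1 \<gamma>2 ..
  note [measurable_cong, simp] = couplingsD(2)[OF \<gamma>(1)] couplingsD(2)[OF \<gamma>(2)]
  define e where "e = empirical_measure n y"
  define g where "g s = emeasure e {s}" for s
  have "emeasure (return borel (y i)) {s} = indicator {y i} s" for i s by (simp add: indicator_def)
  then have "g s = (\<Sum>i=1..n. indicator {y i} s) / of_nat n" for s
    unfolding g_def e_def by (simp only: emeasure_empirical_measure borel_singleton sets.empty_sets)
  then have "g = (\<lambda>s. (\<Sum>i=1..n. indicator {y i} s) / of_nat n)" by auto
  then have g_meas [measurable]: "g \<in> borel_measurable borel" by simp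
  have e: "prob_space e"
    using prob_space_empirical_measure[OF n, of y] by (simp add: e_def space_prob_algebra)
  then have g_fin: "g s < \<infinity>" for s
    unfolding g_def by (simp add: prob_space.emeasure_le_1 less_top[symmetric]) (metis e ennreal_one_neq_top finite_measure.emeasure_finite prob_space_def top.not_eq_extremum)
  have "AE s in e. g s \<noteq> 0"
    using AE_empirical_measure[where n = n and x = y]
      emeasure_empirical_singleton_nonzero[where n = n and x = y]
    unfolding e_def g_def by (rule eventually_mono)
  then have AE_g: "AE s in distr \<gamma>1 borel snd. g s \<noteq> 0" "AE s in distr \<gamma>2 borel fst. g s \<noteq> 0"
    unfolding e_def couplingsD(4)[OF \<gamma>(1)] couplingsD(3)[OF \<gamma>(2)] by auto
  have AE1: "AE u in \<gamma>1. g (snd u) \<noteq> 0" using AE_g(1) by (subst (asm) AE_distr_iff) auto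
  have AE2: "AE v in \<gamma>2. g (fst v) \<noteq> 0" using AE_g(2) by (subst (asm) AE_distr_iff) auto
  \<comment> \<open>Density of the glued law with respect to the product: the two middle points agree, which has
    positive probability because the middle measure is finitely supported.\<close>
  define D where "D z = (if snd (fst z) = fst (snd z) then inverse (g (snd (fst z))) else 0)"
    for z :: "('a \<times> 'a) \<times> ('a \<times> 'a)"
  have D_meas [measurable]: "D \<in> borel_measurable (\<gamma>1 \<Otimes>\<^sub>M \<gamma>2)" unfolding D_def[abs_def] by measurable
  \<comment> \<open>Integrating out either factor gives 1 at every middle point that is an atom, and
    almost every middle point is one. Hence \<open>\<gamma>1\<close> and \<open>\<gamma>2\<close>
    are the two marginals of the glued density.\<close>
  have D1: "(\<integral>\<^sup>+v. D (u, v) \<partial>\<gamma>2) = 1" if "g (snd u) \<noteq> 0" for u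
  proof -
    have "(\<integral>\<^sup>+v. D (u, v) \<partial>\<gamma>2) = (\<integral>\<^sup>+v. inverse (g (snd u)) * indicator {snd u} (fst v) \<partial>\<gamma>2)"
      by (intro nn_integral_cong) (auto simp: D_def indicator_def)
    also have "\<dots> = inverse (g (snd u)) * g (snd u)"
      by (subst nn_integral_cmult) (auto simp: nn_integral_coupling_fst[OF \<gamma>(2)] g_def e_def empirical_measure_def)
    also have "\<dots> = 1" using that g_fin[of "snd u"]
      by (metis ennreal_divide_self divide_ennreal_def infinity_ennreal_def less_irrefl mult.commute)
    finally show ?thesis .
  qed
  have D2: "(\<integral>\<^sup>+u. D (u, v) \<partial>\<gamma>1) = 1" if "g (fst v) \<noteq> 0" for v
  proof -
    have "(\<integral>\<^sup>+u. D (u, v) \<partial>\<gamma>1) = (\<integral>\<^sup>+u. inverse (g (fst v)) * indicator {fst v} (snd u) \<partial>\<gamma>1)"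
      by (intro nn_integral_cong) (auto simp: D_def indicator_def)
    also have "\<dots> = inverse (g (fst v)) * g (fst v)"
      by (subst nn_integral_cmult) (auto simp: nn_integral_coupling_snd[OF \<gamma>(1)] g_def e_def empirical_measure_def)
    also have "\<dots> = 1" using that g_fin[of "fst v"]
      by (metis ennreal_divide_self divide_ennreal_def infinity_ennreal_def less_irrefl mult.commute)
    finally show ?thesis .
  qed
  have int1: "(\<integral>\<^sup>+z. D z * a (fst z) \<partial>(\<gamma>1 \<Otimes>\<^sub>M \<gamma>2)) = (\<integral>\<^sup>+u. a u \<partial>\<gamma>1)"
    if [measurable]: "a \<in> borel_measurable ?B" for a
  proof -
    have "(\<integral>\<^sup>+z. D z * a (fst z) \<partial>(\<gamma>1 \<Otimes>\<^sub>M \<gamma>2)) = (\<integral>\<^sup>+u. (\<integral>\<^sup>+v. D (u, v) * a u \<partial>\<gamma>2) \<partial>\<gamma>1)"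
      by (subst g2.nn_integral_fst[symmetric]) auto
    also have "\<dots> = (\<integral>\<^sup>+u. a u \<partial>\<gamma>1)"
      using AE1 by (intro nn_integral_cong_AE) (auto simp: nn_integral_multc D1 elim!: eventually_mono)
    finally show ?thesis .
  qed
  have int2: "(\<integral>\<^sup>+z. D z * a (snd z) \<partial>(\<gamma>1 \<Otimes>\<^sub>M \<gamma>2)) = (\<integral>\<^sup>+v. a v \<partial>\<gamma>2)"
    if [measurable]: "a \<in> borel_measurable ?B" for a
  proof -
    have "(\<integral>\<^sup>+z. D z * a (snd z) \<partial>(\<gamma>1 \<Otimes>\<^sub>M \<gamma>2)) = (\<integral>\<^sup>+v. (\<integral>\<^sup>+u. D (u, v) * a v \<partial>\<gamma>1) \<partial>\<gamma>2)"
      by (subst P.nn_integral_snd[symmetric]) auto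
    also have "\<dots> = (\<integral>\<^sup>+v. a v \<partial>\<gamma>2)"
      using AE2 by (intro nn_integral_cong_AE) (auto simp: nn_integral_multc D2 elim!: eventually_mono)
    finally show ?thesis .
  qed
  define T where "T z = (fst (fst z), snd (snd z))" for z :: "('a \<times> 'a) \<times> ('a \<times> 'a)"
  have T_meas [measurable]: "T \<in> measurable (\<gamma>1 \<Otimes>\<^sub>M \<gamma>2) ?B" unfolding T_def[abs_def] by measurable
  define \<gamma> where "\<gamma> = distr (density (\<gamma>1 \<Otimes>\<^sub>M \<gamma>2) D) ?B T"
  have int: "(\<integral>\<^sup>+z. h z \<partial>\<gamma>) = (\<integral>\<^sup>+z. D z * h (T z) \<partial>(\<gamma>1 \<Otimes>\<^sub>M \<gamma>2))"
    if [measurable]: "h \<in> borel_measurable ?B" for h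
    unfolding \<gamma>_def by (subst nn_integral_distr) (auto simp: nn_integral_density)
  have sets_g [simp]: "sets \<gamma> = sets ?B" by (simp add: \<gamma>_def)
  have m_g: "measurable \<gamma> N = measurable ?B N" for N :: "'a measure" by (rule measurable_cong_sets) auto
  have fst_distr: "distr \<gamma> borel fst = \<mu>"
  proof (rule measure_eqI)
    fix A assume "A \<in> sets (distr \<gamma> borel fst)"
    then have A [measurable]: "A \<in> sets borel" by simp
    have "emeasure (distr \<gamma> borel fst) A = (\<integral>\<^sup>+z. indicator A (fst z) \<partial>\<gamma>)"
      using A by (subst nn_integral_indicator[symmetric], simp, subst nn_integral_distr) (auto simp: m_g)
    also have "\<dots> = (\<integral>\<^sup>+z. D z * indicator A (fst (fst z)) \<partial>(\<gamma>1 \<Otimes>\<^sub>M \<gamma>2))"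
      using int[of "\<lambda>z. indicator A (fst z)"] by (simp add: T_def)
    also have "\<dots> = (\<integral>\<^sup>+u. indicator A (fst u) \<partial>\<gamma>1)" by (rule int1) simp
    also have "\<dots> = (\<integral>\<^sup>+u. indicator A u \<partial>\<mu>)" by (rule nn_integral_coupling_fst[OF \<gamma>(1)]) simp
    also have "\<dots> = emeasure \<mu> A" using A couplingsD(3)[OF \<gamma>(1)] by (metis nn_integral_indicator sets_distr)
    finally show "emeasure (distr \<gamma> borel fst) A = emeasure \<mu> A" .
  qed (use couplingsD(3)[OF \<gamma>(1)] in auto)
  have snd_distr: "distr \<gamma> borel snd = \<nu>"
  proof (rule measure_eqI)
    fix A assume "A \<in> sets (distr \<gamma> borel snd)"
    then have A [measurable]: "A \<in> sets borel" by simp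
    have "emeasure (distr \<gamma> borel snd) A = (\<integral>\<^sup>+z. indicator A (snd z) \<partial>\<gamma>)"
      using A by (subst nn_integral_indicator[symmetric], simp, subst nn_integral_distr) (auto simp: m_g)
    also have "\<dots> = (\<integral>\<^sup>+z. D z * indicator A (snd (snd z)) \<partial>(\<gamma>1 \<Otimes>\<^sub>M \<gamma>2))"
      using int[of "\<lambda>z. indicator A (snd z)"] by (simp add: T_def)
    also have "\<dots> = (\<integral>\<^sup>+u. indicator A (snd u) \<partial>\<gamma>2)" by (rule int2) simp
    also have "\<dots> = (\<integral>\<^sup>+u. indicator A u \<partial>\<nu>)" by (rule nn_integral_coupling_snd[OF \<gamma>(2)]) simp
    also have "\<dots> = emeasure \<nu> A" using A couplingsD(4)[OF \<gamma>(2)] by (metis nn_integral_indicator sets_distr)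
    finally show "emeasure (distr \<gamma> borel snd) A = emeasure \<nu> A" .
  qed (use couplingsD(4)[OF \<gamma>(2)] in auto)
  have "prob_space \<gamma>"
  proof
    have "emeasure \<gamma> (space \<gamma>) = (\<integral>\<^sup>+z. 1 \<partial>\<gamma>)" by simp
    also have "\<dots> = (\<integral>\<^sup>+u. 1 \<partial>\<gamma>1)" using int[of "\<lambda>_. 1"] int1[of "\<lambda>_. 1"] by simp
    finally show "emeasure \<gamma> (space \<gamma>) = 1" by (simp add: g1.emeasure_space_1)
  qed
  then have mem: "\<gamma> \<in> couplings \<mu> \<nu>"
    using fst_distr snd_distr by (simp add: couplings_def space_prob_algebra)
  show thesis
  proof (rule that[OF mem])
    fix C C1 C2 :: "'a \<times> 'a \<Rightarrow> ennreal"
    assume [measurable]: "C \<in> borel_measurable ?B" "C1 \<in> borel_measurable ?B" "C2 \<in> borel_measurable ?B"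
      and le: "\<And>x y z. C (x, z) \<le> C1 (x, y) + C2 (y, z)"
    have "(\<integral>\<^sup>+z. C z \<partial>\<gamma>) = (\<integral>\<^sup>+z. D z * C (T z) \<partial>(\<gamma>1 \<Otimes>\<^sub>M \<gamma>2))" by (rule int) simp
    also have "\<dots> \<le> (\<integral>\<^sup>+z. D z * C1 (fst z) + D z * C2 (snd z) \<partial>(\<gamma>1 \<Otimes>\<^sub>M \<gamma>2))"
    proof (intro nn_integral_mono)
      fix z :: "('a \<times> 'a) \<times> ('a \<times> 'a)"
      have "C (T z) \<le> C1 (fst z) + C2 (snd z)" if "snd (fst z) = fst (snd z)"
        using le[of "fst (fst z)" "snd (snd z)" "snd (fst z)"] that
        by (metis T_def prod.collapse)
      then show "D z * C (T z) \<le> D z * C1 (fst z) + D z * C2 (snd z)"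
        by (auto simp: D_def mult_left_mono simp flip: distrib_left)
    qed
    also have "\<dots> = (\<integral>\<^sup>+z. D z * C1 (fst z) \<partial>(\<gamma>1 \<Otimes>\<^sub>M \<gamma>2)) + (\<integral>\<^sup>+z. D z * C2 (snd z) \<partial>(\<gamma>1 \<Otimes>\<^sub>M \<gamma>2))"
      by (intro nn_integral_add) measurable
    also have "\<dots> = (\<integral>\<^sup>+z. C1 z \<partial>\<gamma>1) + (\<integral>\<^sup>+z. C2 z \<partial>\<gamma>2)" by (simp add: int1 int2)
    finally show "(\<integral>\<^sup>+z. C z \<partial>\<gamma>) \<le> (\<integral>\<^sup>+z. C1 z \<partial>\<gamma>1) + (\<integral>\<^sup>+z. C2 z \<partial>\<gamma>2)" .
  qed
qed

text \<open>Three separate costs are allowed because the triangle inequality of order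
  \<open>p\<close> is run with two differently weighted powers of the distance.\<close>

lemma transport_via_empirical_le:
  fixes y :: "nat \<Rightarrow> 'a::euclidean_space"
  assumes "n > 0" "\<gamma>1 \<in> couplings \<mu> (empirical_measure n y)"
    "\<gamma>2 \<in> couplings (empirical_measure n y) \<nu>"
    "C \<in> borel_measurable (borel \<Otimes>\<^sub>M borel)"
    "C1 \<in> borel_measurable (borel \<Otimes>\<^sub>M borel)" "C2 \<in> borel_measurable (borel \<Otimes>\<^sub>M borel)"
    "\<And>z. C1 z \<ge> (0::real)" "\<And>z. C2 z \<ge> (0::real)" "\<And>x y z. C (x, z) \<le> C1 (x, y) + C2 (y, z)"
  shows "(INF \<pi>\<in>couplings \<mu> \<nu>. \<integral>\<^sup>+z. ennreal (C z) \<partial>\<pi>)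
    \<le> (\<integral>\<^sup>+z. ennreal (C1 z) \<partial>\<gamma>1) + (\<integral>\<^sup>+z. ennreal (C2 z) \<partial>\<gamma>2)"
proof (rule glue_couplings[OF assms(1-3)])
  fix \<gamma> assume \<gamma>: "\<gamma> \<in> couplings \<mu> \<nu>"
    and le: "\<And>C C1 C2 :: 'a \<times> 'a \<Rightarrow> ennreal. \<lbrakk>C \<in> borel_measurable (borel \<Otimes>\<^sub>M borel);
       C1 \<in> borel_measurable (borel \<Otimes>\<^sub>M borel); C2 \<in> borel_measurable (borel \<Otimes>\<^sub>M borel);
       \<And>x y z. C (x, z) \<le> C1 (x, y) + C2 (y, z)\<rbrakk>
      \<Longrightarrow> (\<integral>\<^sup>+z. C z \<partial>\<gamma>) \<le> (\<integral>\<^sup>+z. C1 z \<partial>\<gamma>1) + (\<integral>\<^sup>+z. C2 z \<partial>\<gamma>2)"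
  have "(\<integral>\<^sup>+z. ennreal (C z) \<partial>\<gamma>) \<le> (\<integral>\<^sup>+z. ennreal (C1 z) \<partial>\<gamma>1) + (\<integral>\<^sup>+z. ennreal (C2 z) \<partial>\<gamma>2)"
    using assms(4-9) by (intro le) (auto simp flip: ennreal_plus intro!: ennreal_leI)
  with \<gamma> show ?thesis by (rule INF_lower2)
qed

text \<open>Gluing over an arbitrary middle measure would need a disintegration; the dual potential avoids it.\<close>

lemma transport_from_empirical_le:
  fixes x :: "nat \<Rightarrow> 'a::euclidean_space"
  assumes n: "n > 0" and \<nu>: "\<nu> \<in> space (prob_algebra borel)"
    and \<gamma>: "\<gamma>1 \<in> couplings (empirical_measure n x) \<mu>" "\<gamma>2 \<in> couplings \<mu> \<nu>"
    and C [measurable]: "C \<in> borel_measurable (borel \<Otimes>\<^sub>M borel)"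
    and C1 [measurable]: "C1 \<in> borel_measurable (borel \<Otimes>\<^sub>M borel)"
    and C2 [measurable]: "C2 \<in> borel_measurable (borel \<Otimes>\<^sub>M borel)"
    and nonneg: "\<And>z. C z \<ge> (0::real)" "\<And>z. C1 z \<ge> (0::real)" "\<And>z. C2 z \<ge> (0::real)"
    and le: "\<And>x y z. C (x, z) \<le> C1 (x, y) + C2 (y, z)"
  shows "(INF \<pi>\<in>couplings (empirical_measure n x) \<nu>. \<integral>\<^sup>+z. ennreal (C z) \<partial>\<pi>)
    \<le> (\<integral>\<^sup>+z. ennreal (C1 z) \<partial>\<gamma>1) + (\<integral>\<^sup>+z. ennreal (C2 z) \<partial>\<gamma>2)" (is "?I \<le> ?R")
proof (rule ennreal_le_epsilon)
  fix \<epsilon> :: real assume \<epsilon>: "0 < \<epsilon>"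
  obtain \<psi> \<pi> where \<psi>: "\<And>i. i \<in> {1..n} \<Longrightarrow> \<psi> i \<ge> 0" and \<pi>: "\<pi> \<in> couplings (empirical_measure n x) \<nu>"
    and dual: "(\<integral>\<^sup>+z. ennreal (C z) \<partial>\<pi>) + ennreal ((\<Sum>i=1..n. \<psi> i) / real n)
       \<le> (\<integral>\<^sup>+y. ennreal (Min ((\<lambda>i. C (x i, y) + \<psi> i) ` {1..n})) \<partial>\<nu>) + ennreal \<epsilon>"
    using semidiscrete_duality[OF \<nu> n C nonneg(1) \<epsilon>, of x] by blast
  define a where "a = ennreal ((\<Sum>i=1..n. \<psi> i) / real n)"
  define m where "m z = Min ((\<lambda>i. C (x i, z) + \<psi> i) ` {1..n})" for z
  \<comment> \<open>\<open>\<psi>\<close> was chosen for the cost \<open>C\<close> towards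
    \<open>\<nu>\<close>. Paired with \<open>C1\<close> it is still admissible between the empirical
    measure and \<open>\<mu>\<close>, and the inequality between the costs becomes
    \<open>m z \<le> h y + C2 (y, z)\<close>, which is integrated along
    \<open>\<gamma>2\<close>.\<close>
  define h where "h y = Min ((\<lambda>i. C1 (x i, y) + \<psi> i) ` {1..n})" for y
  have [measurable]: "m \<in> borel_measurable borel" "h \<in> borel_measurable borel"
    unfolding m_def[abs_def] h_def[abs_def] using n by (auto intro!: borel_measurable_Min)
  have h_nonneg: "h y \<ge> 0" for y unfolding h_def using n \<psi> nonneg by (subst Min_ge_iff) auto
  have m_le: "m z \<le> h y + C2 (y, z)" for y z
  proof -
    have "h y \<in> (\<lambda>i. C1 (x i, y) + \<psi> i) ` {1..n}" unfolding h_def using n by (intro Min_in) auto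
    then obtain i where i: "i \<in> {1..n}" "h y = C1 (x i, y) + \<psi> i" by auto
    then have "m z \<le> C (x i, z) + \<psi> i" unfolding m_def by (intro Min_le) auto
    then show ?thesis using i le[of "x i" z y] by simp
  qed
  have "(\<integral>\<^sup>+z. ennreal (m z) \<partial>\<nu>) = (\<integral>\<^sup>+v. ennreal (m (snd v)) \<partial>\<gamma>2)"
    by (rule nn_integral_coupling_snd[OF \<gamma>(2), symmetric]) measurable
  also have "\<dots> \<le> (\<integral>\<^sup>+v. ennreal (h (fst v)) + ennreal (C2 v) \<partial>\<gamma>2)"
  proof (intro nn_integral_mono)
    fix v
    show "ennreal (m (snd v)) \<le> ennreal (h (fst v)) + ennreal (C2 v)"
      using m_le[of "snd v" "fst v"] h_nonneg nonneg(3) by (simp add: ennreal_leI flip: ennreal_plus)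
  qed
  also have "\<dots> = (\<integral>\<^sup>+v. ennreal (h (fst v)) \<partial>\<gamma>2) + (\<integral>\<^sup>+v. ennreal (C2 v) \<partial>\<gamma>2)"
    by (intro nn_integral_add) (auto simp: couplings_measurable[OF \<gamma>(2)])
  also have "(\<integral>\<^sup>+v. ennreal (h (fst v)) \<partial>\<gamma>2) = (\<integral>\<^sup>+y. ennreal (h y) \<partial>\<mu>)"
    by (rule nn_integral_coupling_fst[OF \<gamma>(2)]) measurable
  also have "\<dots> \<le> (\<integral>\<^sup>+z. ennreal (C1 z) \<partial>\<gamma>1) + a"
    unfolding a_def
  proof (rule semidiscrete_weak_duality[OF \<gamma>(1) n])
    fix i y assume i: "i \<in> {1..n}"
    then have "h y \<le> C1 (x i, y) + \<psi> i" unfolding h_def by (intro Min_le) auto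
    then show "ennreal (h y) \<le> ennreal (C1 (x i, y)) + ennreal (\<psi> i)"
      using nonneg \<psi>[OF i] by (simp flip: ennreal_plus)
  qed (use \<psi> in auto)
  finally have "(\<integral>\<^sup>+z. ennreal (m z) \<partial>\<nu>) \<le> ?R + a" by (simp add: add_ac add_right_mono)
  then have "(\<integral>\<^sup>+z. ennreal (C z) \<partial>\<pi>) + a \<le> (?R + ennreal \<epsilon>) + a"
    using dual unfolding a_def[symmetric] m_def[symmetric] by (smt (verit) add.assoc add.commute add_right_mono order_trans)
  \<comment> \<open>\<open>a\<close> is finite, so it cancels even if the integrals are
    infinite.\<close>
  then have "(\<integral>\<^sup>+z. ennreal (C z) \<partial>\<pi>) \<le> ?R + ennreal \<epsilon>"
    by (simp add: a_def ennreal_add_left_cancel_le add.commute[of _ "ennreal (_ / _)"])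
  with \<pi> show "?I \<le> ?R + ennreal \<epsilon>" by (rule INF_lower2)
qed

section \<open>Triangle inequality for the distance of order \<open>p\<close>\<close>

lemma wasserstein_le_iff:
  assumes p: "p \<ge> 1" and a: "a \<ge> 0"
  shows "wasserstein p \<mu> \<nu> \<le> ennreal a \<longleftrightarrow>
    (INF \<pi>\<in>couplings \<mu> \<nu>. \<integral>\<^sup>+ z. ennreal (norm (fst z - snd z) powr p) \<partial>\<pi>) \<le> ennreal (a powr p)"
proof -
  \<comment> \<open>An infinite \<open>t\<close> violates both sides, because the bounds are finite.
    The equivalence lets the triangle inequality and lower semicontinuity be proved for costs,
    without roots.\<close>
  have "ennreal_powr t (1 / p) \<le> ennreal a \<longleftrightarrow> t \<le> ennreal (a powr p)" for t
  proof (cases t)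
    case (real r)
    have "r powr (1 / p) \<le> a \<longleftrightarrow> r \<le> a powr p"
    proof
      assume "r powr (1 / p) \<le> a"
      then have "(r powr (1 / p)) powr p \<le> a powr p" using p by (intro powr_mono2) auto
      then show "r \<le> a powr p" using p real by (simp add: powr_powr)
    next
      assume "r \<le> a powr p"
      then have "r powr (1 / p) \<le> (a powr p) powr (1 / p)" using p real by (intro powr_mono2) auto
      then show "r powr (1 / p) \<le> a" using p a by (simp add: powr_powr)
    qed
    then show ?thesis using real a by (simp add: ennreal_powr_def ennreal_le_iff)
  qed (simp add: ennreal_powr_def top_unique)
  then show ?thesis unfolding wasserstein_def .
qed

text \<open>Jensen's inequality for the \<open>p\<close>-th power at \<open>a / A\<close> and
  \<open>b / B\<close>, with weights \<open>A / (A + B)\<close> and \<open>B / (A + B)\<close>.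
  Equality holds for \<open>a = A\<close> and \<open>b = B\<close>, so little is lost when
  \<open>A\<close> and \<open>B\<close> are close to the two distances.\<close>

lemma powr_add_le:
  fixes a b A B p :: real
  assumes p: "p \<ge> 1" and "a \<ge> 0" "b \<ge> 0" and A: "A > 0" and B: "B > 0"
  shows "(a + b) powr p \<le> (A + B) powr (p - 1) * (A powr (1 - p) * a powr p + B powr (1 - p) * b powr p)"
proof -
  define t where "t = A / (A + B)"
  have t: "0 < t" "t < 1" "1 - t = B / (A + B)" using A B by (auto simp: t_def field_simps)
  have cvx: "(t * u + (1 - t) * v) powr p \<le> t * u powr p + (1 - t) * v powr p" if "u \<ge> 0" "v \<ge> 0" for u v
  proof -
    \<comment> \<open>Convexity is applied to positive arguments; if \<open>u\<close> or
      \<open>v\<close> is 0, the claim reduces to \<open>s powr p \<le> s\<close> for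
      \<open>0 < s < 1\<close>.\<close>
    have lin: "(s * w) powr p \<le> s * w powr p" if "0 < s" "s < 1" "w \<ge> 0" for s w :: real
    proof -
      have "s powr p \<le> s powr 1" using that p by (intro powr_mono') auto
      then show ?thesis using that by (simp add: powr_mult mult_right_mono)
    qed
    from that have "u = 0 \<or> v = 0 \<or> u > 0 \<and> v > 0" by linarith
    then consider "u = 0" | "v = 0" | "u > 0" "v > 0" by blast
    then show ?thesis
    proof cases
      case 3
      then show ?thesis
        using convex_onD[OF powr_convex[OF p], of "1 - t" u v] t(1,2) by simp
    qed (use lin[of t u] lin[of "1 - t" v] that t in auto)
  qed
  have "t * (a / A) + (1 - t) * (b / B) = (a + b) / (A + B)"
    unfolding t(3) unfolding t_def using A B by (simp add: add_divide_distrib)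
  then have "((a + b) / (A + B)) powr p \<le> t * (a / A) powr p + (1 - t) * (b / B) powr p"
    using cvx[of "a / A" "b / B"] assms by simp
  then have "(a + b) powr p \<le> (A + B) powr p * (t * (a / A) powr p + (1 - t) * (b / B) powr p)"
    using assms by (simp add: powr_divide field_simps)
  also have "\<dots> = (A + B) powr (p - 1) * (A powr (1 - p) * a powr p + B powr (1 - p) * b powr p)"
    unfolding t(3) unfolding t_def using assms
    by (simp add: powr_divide powr_diff distrib_left)
  finally show ?thesis .
qed

text \<open>
  The weighted costs \<open>K1\<close>, \<open>K2\<close> in the proof come from convexity of the \<open>p\<close>-th power and replace
  Minkowski's inequality.
\<close>

lemma wasserstein_triangle_of_gluing:
  fixes \<mu> \<nu> \<rho> :: "'a::euclidean_space measure"
  assumes p: "p \<ge> 1"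
    and glue: "\<And>C C1 C2 \<gamma>1 \<gamma>2. \<lbrakk>\<gamma>1 \<in> couplings \<mu> \<nu>; \<gamma>2 \<in> couplings \<nu> \<rho>;
       C \<in> borel_measurable (borel \<Otimes>\<^sub>M borel);
       C1 \<in> borel_measurable (borel \<Otimes>\<^sub>M borel); C2 \<in> borel_measurable (borel \<Otimes>\<^sub>M borel);
       \<And>z. C z \<ge> (0::real); \<And>z. C1 z \<ge> (0::real); \<And>z. C2 z \<ge> (0::real);
       \<And>x y z. C (x, z) \<le> C1 (x, y) + C2 (y, z)\<rbrakk>
      \<Longrightarrow> (INF \<pi>\<in>couplings \<mu> \<rho>. \<integral>\<^sup>+z. ennreal (C z) \<partial>\<pi>)
            \<le> (\<integral>\<^sup>+z. ennreal (C1 z) \<partial>\<gamma>1) + (\<integral>\<^sup>+z. ennreal (C2 z) \<partial>\<gamma>2)"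
  shows "wasserstein p \<mu> \<rho> \<le> wasserstein p \<mu> \<nu> + wasserstein p \<nu> \<rho>"
proof (rule ennreal_le_epsilon)
  fix \<epsilon> :: real assume fin: "wasserstein p \<mu> \<nu> + wasserstein p \<nu> \<rho> < \<top>" and \<epsilon>: "0 < \<epsilon>"
  define N where "N z = norm (fst z - snd z) powr p" for z :: "'a \<times> 'a"
  have N_meas [measurable]: "N \<in> borel_measurable (borel \<Otimes>\<^sub>M borel)" unfolding N_def[abs_def] by measurable
  have coupling: "\<exists>\<gamma>\<in>couplings \<alpha> \<beta>. (\<integral>\<^sup>+z. ennreal (N z) \<partial>\<gamma>) \<le> ennreal ((r + \<epsilon> / 2) powr p)"
    if "wasserstein p \<alpha> \<beta> = ennreal r" "r \<ge> 0" for \<alpha> \<beta> :: "'a measure" and r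
  proof -
    have "(INF \<gamma>\<in>couplings \<alpha> \<beta>. \<integral>\<^sup>+z. ennreal (N z) \<partial>\<gamma>) \<le> ennreal (r powr p)"
      using wasserstein_le_iff[OF p \<open>r \<ge> 0\<close>, of \<alpha> \<beta>] that by (simp add: N_def)
    also have "\<dots> < ennreal ((r + \<epsilon> / 2) powr p)"
      using that \<epsilon> p by (intro ennreal_lessI) (auto intro!: powr_less_mono2)
    finally show ?thesis by (auto simp: INF_less_iff intro: less_imp_le)
  qed
  obtain r where r: "wasserstein p \<mu> \<nu> = ennreal r" "r \<ge> 0"
    using fin by (cases "wasserstein p \<mu> \<nu>") auto
  obtain s where s: "wasserstein p \<nu> \<rho> = ennreal s" "s \<ge> 0"
    using fin by (cases "wasserstein p \<nu> \<rho>") auto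
  \<comment> \<open>The slack keeps \<open>A\<close> and \<open>B\<close> positive even if a
    distance vanishes, as the exponent \<open>1 - p\<close> requires, and guarantees couplings of
    cost at most \<open>A powr p\<close> and \<open>B powr p\<close>.\<close>
  define A B where "A = r + \<epsilon> / 2" and "B = s + \<epsilon> / 2"
  have AB: "A > 0" "B > 0" using r s \<epsilon> by (auto simp: A_def B_def)
  obtain \<gamma>1 where \<gamma>1: "\<gamma>1 \<in> couplings \<mu> \<nu>" "(\<integral>\<^sup>+z. ennreal (N z) \<partial>\<gamma>1) \<le> ennreal (A powr p)"
    using coupling[OF r] unfolding A_def by blast
  obtain \<gamma>2 where \<gamma>2: "\<gamma>2 \<in> couplings \<nu> \<rho>" "(\<integral>\<^sup>+z. ennreal (N z) \<partial>\<gamma>2) \<le> ennreal (B powr p)"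
    using coupling[OF s] unfolding B_def by blast
  define K1 K2 where "K1 = (A + B) powr (p - 1) * A powr (1 - p)"
    and "K2 = (A + B) powr (p - 1) * B powr (1 - p)"
  have K: "K1 \<ge> 0" "K2 \<ge> 0" by (auto simp: K1_def K2_def)
  \<comment> \<open>The weighted bound is exact at \<open>A\<close> and \<open>B\<close>; this
    recombines the two cost bounds without loss.\<close>
  have "K1 * A powr p + K2 * B powr p = (A + B) powr (p - 1) * (A + B)"
    using AB by (simp add: K1_def K2_def mult.assoc distrib_left flip: powr_add)
  also have "\<dots> = (A + B) powr p" using AB by (simp add: powr_diff)
  finally have K_sum: "K1 * A powr p + K2 * B powr p = (A + B) powr p" .
  have "(INF \<pi>\<in>couplings \<mu> \<rho>. \<integral>\<^sup>+z. ennreal (N z) \<partial>\<pi>)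
      \<le> (\<integral>\<^sup>+z. ennreal (K1 * N z) \<partial>\<gamma>1) + (\<integral>\<^sup>+z. ennreal (K2 * N z) \<partial>\<gamma>2)"
  proof (rule glue[OF \<gamma>1(1) \<gamma>2(1)])
    fix x y z :: 'a
    have "norm (x - z) powr p \<le> (norm (x - y) + norm (y - z)) powr p"
      using p norm_triangle_ineq[of "x - y" "y - z"] by (intro powr_mono2) auto
    also have "\<dots> \<le> K1 * norm (x - y) powr p + K2 * norm (y - z) powr p"
      using powr_add_le[OF p _ _ AB, of "norm (x - y)" "norm (y - z)"]
      by (simp add: K1_def K2_def distrib_left mult.assoc)
    finally show "N (x, z) \<le> K1 * N (x, y) + K2 * N (y, z)" by (simp add: N_def)
  qed (use K in \<open>auto simp: N_def\<close>)
  also have "(\<integral>\<^sup>+z. ennreal (K1 * N z) \<partial>\<gamma>1) = ennreal K1 * (\<integral>\<^sup>+z. ennreal (N z) \<partial>\<gamma>1)"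
    using K by (subst nn_integral_cmult[symmetric])
      (auto simp: couplings_measurable[OF \<gamma>1(1)] ennreal_mult N_def)
  also have "(\<integral>\<^sup>+z. ennreal (K2 * N z) \<partial>\<gamma>2) = ennreal K2 * (\<integral>\<^sup>+z. ennreal (N z) \<partial>\<gamma>2)"
    using K by (subst nn_integral_cmult[symmetric])
      (auto simp: couplings_measurable[OF \<gamma>2(1)] ennreal_mult N_def)
  also have "ennreal K1 * (\<integral>\<^sup>+z. ennreal (N z) \<partial>\<gamma>1) + ennreal K2 * (\<integral>\<^sup>+z. ennreal (N z) \<partial>\<gamma>2)
      \<le> ennreal K1 * ennreal (A powr p) + ennreal K2 * ennreal (B powr p)"
    using \<gamma>1(2) \<gamma>2(2) by (intro add_mono mult_left_mono) auto
  also have "\<dots> = ennreal ((A + B) powr p)"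
    using K by (simp add: K_sum flip: ennreal_mult ennreal_plus)
  finally have "wasserstein p \<mu> \<rho> \<le> ennreal (A + B)"
    using wasserstein_le_iff[OF p, of "A + B" \<mu> \<rho>] AB by (simp add: N_def)
  also have "ennreal (A + B) = wasserstein p \<mu> \<nu> + wasserstein p \<nu> \<rho> + ennreal \<epsilon>"
    using r s \<epsilon> by (simp add: A_def B_def field_simps flip: ennreal_plus)
  finally show "wasserstein p \<mu> \<rho> \<le> wasserstein p \<mu> \<nu> + wasserstein p \<nu> \<rho> + ennreal \<epsilon>" .
qed

text \<open>With the data law and a model law at the ends, this bounds the limiting objective by the
  empirical one; the version with the empirical measure at the left end gives the reverse
  bound.\<close>

lemma wasserstein_triangle_empirical_mid:
  fixes y :: "nat \<Rightarrow> 'a::euclidean_space"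
  assumes "p \<ge> 1" "n > 0"
  shows "wasserstein p \<mu> \<rho>
    \<le> wasserstein p \<mu> (empirical_measure n y) + wasserstein p (empirical_measure n y) \<rho>"
  by (rule wasserstein_triangle_of_gluing[OF assms(1)]) (rule transport_via_empirical_le[OF assms(2)])

lemma wasserstein_triangle_empirical_left:
  fixes x :: "nat \<Rightarrow> 'a::euclidean_space"
  assumes "p \<ge> 1" "n > 0" "\<rho> \<in> space (prob_algebra borel)"
  shows "wasserstein p (empirical_measure n x) \<rho>
    \<le> wasserstein p (empirical_measure n x) \<nu> + wasserstein p \<nu> \<rho>"
  by (rule wasserstein_triangle_of_gluing[OF assms(1)]) (rule transport_from_empirical_le[OF assms(2,3)])

section \<open>Symmetry and contractions\<close>

lemma coupling_distr:
  assumes \<pi>: "\<pi> \<in> couplings \<mu> \<nu>"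
    and f [measurable]: "f \<in> measurable borel borel" and g [measurable]: "g \<in> measurable borel borel"
  shows "distr \<pi> (borel \<Otimes>\<^sub>M borel) (\<lambda>z. (f (fst z), g (snd z))) \<in> couplings (distr \<mu> borel f) (distr \<nu> borel g)"
proof -
  have [measurable]: "(\<lambda>z. (f (fst z), g (snd z))) \<in> measurable \<pi> (borel \<Otimes>\<^sub>M borel)"
    "fst \<in> measurable \<pi> borel" "snd \<in> measurable \<pi> borel"
    unfolding couplings_measurable[OF \<pi>] by measurable
  show ?thesis
    unfolding couplings_def space_prob_algebra couplingsD(3,4)[OF \<pi>, symmetric]
    using couplingsD(1)[OF \<pi>] by (auto simp: distr_distr comp_def intro!: prob_space.prob_space_distr)
qed

lemma wasserstein_commute: "wasserstein p \<mu> \<nu> = wasserstein p \<nu> (\<mu> :: 'a::euclidean_space measure)"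
proof -
  have le: "(INF \<pi>\<in>couplings \<mu> \<nu>. \<integral>\<^sup>+ z. ennreal (norm (fst z - snd z) powr p) \<partial>\<pi>)
     \<le> (INF \<pi>\<in>couplings \<nu> \<mu>. \<integral>\<^sup>+ z. ennreal (norm (fst z - snd z) powr p) \<partial>\<pi>)"
    for \<mu> \<nu> :: "'a measure"
  proof (rule INF_greatest)
    fix \<pi> assume \<pi>: "\<pi> \<in> couplings \<nu> \<mu>"
    let ?s = "\<lambda>z. (snd z, fst z) :: 'a \<times> 'a"
    have [measurable]: "?s \<in> measurable \<pi> (borel \<Otimes>\<^sub>M borel)"
      "fst \<in> measurable \<pi> borel" "snd \<in> measurable \<pi> borel"
      unfolding couplings_measurable[OF \<pi>] by measurable
    have "distr \<pi> (borel \<Otimes>\<^sub>M borel) ?s \<in> couplings \<mu> \<nu>"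
      unfolding couplings_def space_prob_algebra couplingsD(3,4)[OF \<pi>, symmetric]
      using couplingsD(1)[OF \<pi>] by (auto simp: distr_distr comp_def intro!: prob_space.prob_space_distr)
    then show "(INF \<pi>\<in>couplings \<mu> \<nu>. \<integral>\<^sup>+ z. ennreal (norm (fst z - snd z) powr p) \<partial>\<pi>)
      \<le> (\<integral>\<^sup>+ z. ennreal (norm (fst z - snd z) powr p) \<partial>\<pi>)"
    proof (rule INF_lower2)
      have "(\<integral>\<^sup>+ z. ennreal (norm (fst z - snd z) powr p) \<partial>distr \<pi> (borel \<Otimes>\<^sub>M borel) ?s)
        = (\<integral>\<^sup>+ z. ennreal (norm (snd z - fst z) powr p) \<partial>\<pi>)"
        by (subst nn_integral_distr) auto
      then show "(\<integral>\<^sup>+ z. ennreal (norm (fst z - snd z) powr p) \<partial>distr \<pi> (borel \<Otimes>\<^sub>M borel) ?s)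
        \<le> (\<integral>\<^sup>+ z. ennreal (norm (fst z - snd z) powr p) \<partial>\<pi>)"
        by (simp only: norm_minus_commute order_refl)
    qed
  qed
  show ?thesis unfolding wasserstein_def by (rule arg_cong2[OF antisym[OF le le] refl])
qed

lemma ennreal_powr_mono: "a \<ge> 0 \<Longrightarrow> x \<le> y \<Longrightarrow> ennreal_powr x a \<le> ennreal_powr y a"
  by (cases x; cases y) (auto simp: ennreal_powr_def top_unique intro!: ennreal_leI powr_mono2)

text \<open>A coupling pushed forward by \<open>f\<close> in both coordinates couples the images,
  and its cost cannot grow because distances do not.\<close>

lemma wasserstein_distr_le:
  fixes f :: "'a::euclidean_space \<Rightarrow> 'b::euclidean_space"
  assumes p: "p \<ge> 1" and f [measurable]: "f \<in> borel_measurable borel"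
    and lip: "\<And>x y. norm (f x - f y) \<le> norm (x - y)"
  shows "wasserstein p (distr \<mu> borel f) (distr \<nu> borel f) \<le> wasserstein p \<mu> \<nu>"
  unfolding wasserstein_def
proof (rule ennreal_powr_mono, use p in simp, rule INF_greatest)
  fix \<pi> assume \<pi>: "\<pi> \<in> couplings \<mu> \<nu>"
  let ?f = "\<lambda>z. (f (fst z), f (snd z))"
  have [measurable]: "?f \<in> measurable \<pi> (borel \<Otimes>\<^sub>M borel)"
    unfolding couplings_measurable[OF \<pi>] by measurable
  have "(\<integral>\<^sup>+ z. ennreal (norm (fst z - snd z) powr p) \<partial>distr \<pi> (borel \<Otimes>\<^sub>M borel) ?f)
      = (\<integral>\<^sup>+ z. ennreal (norm (f (fst z) - f (snd z)) powr p) \<partial>\<pi>)"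
    by (simp add: nn_integral_distr)
  also have "\<dots> \<le> (\<integral>\<^sup>+ z. ennreal (norm (fst z - snd z) powr p) \<partial>\<pi>)"
    using p lip by (intro nn_integral_mono ennreal_leI powr_mono2) auto
  finally show "(INF \<pi>\<in>couplings (distr \<mu> borel f) (distr \<nu> borel f).
      \<integral>\<^sup>+ z. ennreal (norm (fst z - snd z) powr p) \<partial>\<pi>)
    \<le> (\<integral>\<^sup>+ z. ennreal (norm (fst z - snd z) powr p) \<partial>\<pi>)"
    by (rule INF_lower2[OF coupling_distr[OF \<pi> f f]])
qed

section \<open>Lower semicontinuity\<close>

text \<open>Weak convergence tests bounded functions only, so \<open>m\<close> is truncated at
  height \<open>k\<close>. Each truncation inherits the bound, and monotone convergence removes the
  cutoff.\<close>

lemma nn_integral_weak_limit_le: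
  fixes m :: "'a::topological_space \<Rightarrow> real"
  assumes conv: "weakly_converges \<mu>s \<mu>"
    and prob: "\<And>j. \<mu>s j \<in> space (prob_algebra borel)" "\<mu> \<in> space (prob_algebra borel)"
    and m: "continuous_on UNIV m" "\<And>y. m y \<ge> 0"
    and le: "\<And>j. (\<integral>\<^sup>+y. ennreal (m y) \<partial>\<mu>s j) \<le> b"
  shows "(\<integral>\<^sup>+y. ennreal (m y) \<partial>\<mu>) \<le> b"
proof -
  define t where "t k y = min (m y) (real k)" for k y
  have t_cont: "continuous_on UNIV (t k)" for k
    unfolding t_def[abs_def] using m by (intro continuous_on_min continuous_on_const)
  have t_bdd: "0 \<le> t k y" "t k y \<le> real k" for k y using m by (auto simp: t_def)
  have t_meas: "t k \<in> borel_measurable \<rho>" if "\<rho> \<in> space (prob_algebra borel)" for k \<rho>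
  proof -
    have "measurable \<rho> (borel :: real measure) = measurable borel borel"
      using that by (intro measurable_cong_sets) (auto simp: space_prob_algebra)
    then show ?thesis using borel_measurable_continuous_onI[OF t_cont[of k]] by simp
  qed
  have t_int: "(\<integral>\<^sup>+y. ennreal (t k y) \<partial>\<rho>) = ennreal (\<integral>y. t k y \<partial>\<rho>)"
    if \<rho>: "\<rho> \<in> space (prob_algebra borel)" for k \<rho>
  proof -
    interpret prob_space \<rho> using \<rho> by (simp add: space_prob_algebra)
    have "integrable \<rho> (t k)"
      using t_bdd t_meas[OF \<rho>] by (intro integrable_const_bound[where B = "real k"]) auto
    then show ?thesis using t_bdd by (intro nn_integral_eq_integral) auto
  qed
  have t_le: "(\<integral>\<^sup>+y. ennreal (t k y) \<partial>\<mu>) \<le> b" for k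
  proof (rule LIMSEQ_le_const2)
    have "bounded (range (t k))"
      using t_bdd by (intro boundedI[of _ "real k"]) auto
    then have "(\<lambda>j. \<integral>y. t k y \<partial>\<mu>s j) \<longlonglongrightarrow> (\<integral>y. t k y \<partial>\<mu>)"
      using conv t_cont unfolding weakly_converges_def by blast
    then show "(\<lambda>j. \<integral>\<^sup>+y. ennreal (t k y) \<partial>\<mu>s j) \<longlonglongrightarrow> (\<integral>\<^sup>+y. ennreal (t k y) \<partial>\<mu>)"
      unfolding t_int[OF prob(1)] t_int[OF prob(2)] by (rule tendsto_ennrealI)
    have "(\<integral>\<^sup>+y. ennreal (t k y) \<partial>\<mu>s j) \<le> (\<integral>\<^sup>+y. ennreal (m y) \<partial>\<mu>s j)" for j
      by (intro nn_integral_mono ennreal_leI) (simp add: t_def)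
    then show "\<exists>N. \<forall>j\<ge>N. (\<integral>\<^sup>+y. ennreal (t k y) \<partial>\<mu>s j) \<le> b" using le order_trans by blast
  qed
  have "ennreal (m y) = (SUP k. ennreal (t k y))" for y
  proof (rule antisym)
    obtain k where "m y \<le> real k" using real_arch_simple by blast
    then have "m y = t k y" by (simp add: t_def)
    then show "ennreal (m y) \<le> (SUP k. ennreal (t k y))" by (metis SUP_upper UNIV_I)
  qed (auto intro!: SUP_least ennreal_leI simp: t_def)
  then have "(\<integral>\<^sup>+y. ennreal (m y) \<partial>\<mu>) = (\<integral>\<^sup>+y. (SUP k. ennreal (t k y)) \<partial>\<mu>)" by simp
  also have "\<dots> = (SUP k. \<integral>\<^sup>+y. ennreal (t k y) \<partial>\<mu>)"
  proof (rule nn_integral_monotone_convergence_SUP)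
    show "incseq (\<lambda>k y. ennreal (t k y))"
      by (auto simp: incseq_def le_fun_def t_def intro!: ennreal_leI)
    show "(\<lambda>y. ennreal (t k y)) \<in> borel_measurable \<mu>" for k using t_meas[OF prob(2), of k] by simp
  qed
  also have "\<dots> \<le> b" using t_le by (intro SUP_least)
  finally show ?thesis .
qed

lemma continuous_on_Min:
  fixes f :: "'i \<Rightarrow> 'a::topological_space \<Rightarrow> real"
  assumes "finite I" "I \<noteq> {}" "\<And>i. i \<in> I \<Longrightarrow> continuous_on S (f i)"
  shows "continuous_on S (\<lambda>y. Min ((\<lambda>i. f i y) ` I))"
  using assms by (induction rule: finite_ne_induct) (auto intro!: continuous_on_min)

text \<open>One potential, chosen for the limit \<open>\<mu>\<close>, serves all
  \<open>\<mu>s j\<close>: weak duality bounds the integrals of its continuous dual integrand, weak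
  convergence carries the bound to \<open>\<mu>\<close>, and near-optimality of the potential turns
  it into a bound on the cost there.\<close>

lemma wasserstein_empirical_weak_limit_le:
  fixes x :: "nat \<Rightarrow> 'a::euclidean_space"
  assumes p: "p \<ge> 1" and n: "n > 0"
    and prob: "\<And>j. \<mu>s j \<in> space (prob_algebra borel)" "\<mu> \<in> space (prob_algebra borel)"
    and conv: "weakly_converges \<mu>s \<mu>"
    and le: "\<And>j. wasserstein p (empirical_measure n x) (\<mu>s j) \<le> b"
  shows "wasserstein p (empirical_measure n x) \<mu> \<le> b"
proof (cases b)
  case (real a)
  let ?e = "empirical_measure n x"
  define N where "N z = norm (fst z - snd z) powr p" for z :: "'a \<times> 'a"
  have N_meas [measurable]: "N \<in> borel_measurable (borel \<Otimes>\<^sub>M borel)" unfolding N_def[abs_def] by measurable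
  have N_nonneg: "N z \<ge> 0" for z by (simp add: N_def)
  have "(INF \<pi>\<in>couplings ?e \<mu>. \<integral>\<^sup>+z. ennreal (N z) \<partial>\<pi>) \<le> ennreal (a powr p)"
  proof (rule ennreal_le_epsilon)
    fix \<epsilon> :: real assume \<epsilon>: "0 < \<epsilon>"
    obtain \<psi> \<pi> where \<psi>: "\<And>i. i \<in> {1..n} \<Longrightarrow> \<psi> i \<ge> 0" and \<pi>: "\<pi> \<in> couplings ?e \<mu>"
      and dual: "(\<integral>\<^sup>+z. ennreal (N z) \<partial>\<pi>) + ennreal ((\<Sum>i=1..n. \<psi> i) / real n)
         \<le> (\<integral>\<^sup>+y. ennreal (Min ((\<lambda>i. N (x i, y) + \<psi> i) ` {1..n})) \<partial>\<mu>) + ennreal \<epsilon>"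
      using semidiscrete_duality[OF prob(2) n N_meas N_nonneg \<epsilon>, of x] by blast
    define s where "s = (\<Sum>i=1..n. \<psi> i) / real n"
    have s: "s \<ge> 0" unfolding s_def using \<psi> by (intro divide_nonneg_nonneg sum_nonneg) auto
    define m where "m y = Min ((\<lambda>i. N (x i, y) + \<psi> i) ` {1..n})" for y
    have m_cont: "continuous_on UNIV m"
      unfolding m_def[abs_def] N_def using n p
      by (intro continuous_on_Min continuous_intros continuous_on_powr') auto
    then have [measurable]: "m \<in> borel_measurable borel" by (rule borel_measurable_continuous_onI)
    have m_nonneg: "m y \<ge> 0" for y unfolding m_def using n \<psi> N_nonneg by (subst Min_ge_iff) auto
    have "(\<integral>\<^sup>+y. ennreal (m y) \<partial>\<mu>) \<le> ennreal (a powr p) + ennreal s"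
    proof (rule nn_integral_weak_limit_le[OF conv prob m_cont m_nonneg])
      fix j
      have "(\<integral>\<^sup>+y. ennreal (m y) \<partial>\<mu>s j) \<le> (\<integral>\<^sup>+z. ennreal (N z) \<partial>\<pi>) + ennreal s"
        if "\<pi> \<in> couplings ?e (\<mu>s j)" for \<pi>
        unfolding s_def
      proof (rule semidiscrete_weak_duality[OF that n])
        fix i y assume i: "i \<in> {1..n}"
        then have "m y \<le> N (x i, y) + \<psi> i" unfolding m_def by (intro Min_le) auto
        then show "ennreal (m y) \<le> ennreal (N (x i, y)) + ennreal (\<psi> i)"
          using N_nonneg \<psi>[OF i] by (simp flip: ennreal_plus)
      qed (use \<psi> in auto)
      \<comment> \<open>Subtracting the finite \<open>s\<close> first lets the bound pass from
        single couplings to the infimum.\<close>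
      then have "(\<integral>\<^sup>+y. ennreal (m y) \<partial>\<mu>s j) - ennreal s \<le> (INF \<pi>\<in>couplings ?e (\<mu>s j). \<integral>\<^sup>+z. ennreal (N z) \<partial>\<pi>)"
        by (intro INF_greatest) (simp add: ennreal_minus_le_iff add.commute)
      also have "\<dots> \<le> ennreal (a powr p)"
        using le[of j] real wasserstein_le_iff[OF p, of a ?e "\<mu>s j"] by (simp add: N_def)
      finally show "(\<integral>\<^sup>+y. ennreal (m y) \<partial>\<mu>s j) \<le> ennreal (a powr p) + ennreal s"
        by (simp add: ennreal_minus_le_iff add.commute)
    qed
    then have "ennreal s + (\<integral>\<^sup>+z. ennreal (N z) \<partial>\<pi>) \<le> ennreal s + (ennreal (a powr p) + ennreal \<epsilon>)"
      using dual unfolding s_def[symmetric] m_def[symmetric]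
      by (smt (verit) add.assoc add.commute add_right_mono order_trans)
    then have "(\<integral>\<^sup>+z. ennreal (N z) \<partial>\<pi>) \<le> ennreal (a powr p) + ennreal \<epsilon>"
      by (simp add: ennreal_add_left_cancel_le)
    with \<pi> show "(INF \<pi>\<in>couplings ?e \<mu>. \<integral>\<^sup>+z. ennreal (N z) \<partial>\<pi>) \<le> ennreal (a powr p) + ennreal \<epsilon>"
      by (rule INF_lower2)
  qed
  then show ?thesis using real wasserstein_le_iff[OF p, of a ?e \<mu>] by (simp add: N_def)
qed simp

section \<open>The projection robust distance\<close>

lemma continuous_on_transpose_mult: "continuous_on S (\<lambda>x. transpose (E :: real ^ 'k ^ 'd) *v x)"
  by (intro linear_continuous_on matrix_vector_mul_bounded_linear)

lemma borel_measurable_transpose_mult [measurable]: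
  "(\<lambda>x. transpose (E :: real ^ 'k ^ 'd) *v x) \<in> borel_measurable borel"
  by (intro borel_measurable_continuous_onI continuous_on_transpose_mult)

text \<open>This keeps every projected problem semidiscrete, so the results on empirical measures
  apply after projection.\<close>

lemma proj_measure_empirical:
  "proj_measure E (empirical_measure n x) = empirical_measure n (\<lambda>i. transpose E *v x i)"
  unfolding proj_measure_def empirical_measure_def
  by (subst distr_distr) (auto simp: comp_def uniform_count_measure_def measurable_point_measure_eq1)

lemma proj_measure_prob:
  assumes "\<mu> \<in> space (prob_algebra borel)" shows "proj_measure E \<mu> \<in> space (prob_algebra borel)"
proof -
  have "measurable \<mu> (borel :: (real ^ 'a) measure) = measurable borel borel"
    using assms by (intro measurable_cong_sets) (auto simp: space_prob_algebra)
  then show ?thesis using assms unfolding proj_measure_def space_prob_algebra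
    by (auto intro!: prob_space.prob_space_distr)
qed

lemma weakly_converges_proj_measure:
  assumes prob: "\<And>j. \<mu>s j \<in> space (prob_algebra borel)" "\<mu> \<in> space (prob_algebra borel)"
    and conv: "weakly_converges \<mu>s \<mu>"
  shows "weakly_converges (\<lambda>j. proj_measure E (\<mu>s j)) (proj_measure (E :: real ^ 'k ^ 'd) \<mu>)"
  unfolding weakly_converges_def
proof (intro allI impI, elim conjE)
  fix f :: "real ^ 'k \<Rightarrow> real"
  assume f: "continuous_on UNIV f" "bounded (range f)"
  have eq: "(\<integral>x. f x \<partial>proj_measure E \<rho>) = (\<integral>x. f (transpose E *v x) \<partial>\<rho>)"
    if "\<rho> \<in> space (prob_algebra borel)" for \<rho>
  proof -
    have "measurable \<rho> (borel :: (real ^ 'k) measure) = measurable borel borel"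
      using that by (intro measurable_cong_sets) (auto simp: space_prob_algebra)
    then show ?thesis unfolding proj_measure_def
      using f(1) by (intro integral_distr) (auto intro: borel_measurable_continuous_onI)
  qed
  have "continuous_on UNIV (\<lambda>x. f (transpose E *v x))"
    using continuous_on_compose2[OF f(1) continuous_on_transpose_mult] by auto
  moreover have "bounded (range (\<lambda>x. f (transpose E *v x)))"
    by (rule bounded_subset[OF f(2)]) auto
  ultimately show "(\<lambda>j. \<integral>x. f x \<partial>proj_measure E (\<mu>s j)) \<longlonglongrightarrow> (\<integral>x. f x \<partial>proj_measure E \<mu>)"
    unfolding eq[OF prob(1)] eq[OF prob(2)] using conv unfolding weakly_converges_def by blast
qed

text \<open>\<open>E\<close> is an isometry because its columns are orthonormal. By Cauchy-Schwarz,
  \<open>norm (transpose E *v x) ^ 2 = x \<bullet> (E *v (transpose E *v x))\<close> is then at most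
  \<open>norm x * norm (transpose E *v x)\<close>.\<close>

lemma norm_stiefel_le:
  assumes "E \<in> stiefel" shows "norm (transpose E *v x) \<le> norm x"
proof -
  define y where "y = transpose E *v x"
  have "norm (E *v y) ^ 2 = (transpose E *v (E *v y)) \<bullet> y"
    by (simp add: power2_norm_eq_inner dot_lmul_matrix flip: dot_matrix_vector_mul)
  also have "transpose E *v (E *v y) = y"
    using assms by (simp add: stiefel_def matrix_vector_mul_assoc)
  finally have "norm (E *v y) = norm y" by (simp add: power2_norm_eq_inner norm_eq_sqrt_inner)
  have "norm y ^ 2 = x \<bullet> (E *v y)"
    unfolding power2_norm_eq_inner by (simp add: y_def dot_lmul_matrix)
  also have "\<dots> \<le> norm x * norm y"
    using norm_cauchy_schwarz[of x "E *v y"] \<open>norm (E *v y) = norm y\<close> by simp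
  finally show ?thesis unfolding y_def[symmetric]
    by (cases "norm y = 0") (auto simp: power2_eq_square)
qed

lemma PRW_le_wasserstein:
  fixes \<mu> \<nu> :: "(real ^ 'b) measure"
  assumes "p \<ge> 1" shows "PRW TYPE('k::finite) p \<mu> \<nu> \<le> wasserstein p \<mu> \<nu>"
  unfolding PRW_def proj_measure_def
proof (intro SUP_least wasserstein_distr_le assms borel_measurable_transpose_mult)
  fix E :: "real ^ 'k ^ 'b" and x y
  assume "E \<in> stiefel"
  then show "norm (transpose E *v x - transpose E *v y) \<le> norm (x - y)"
    unfolding matrix_vector_mult_diff_distrib[symmetric] by (rule norm_stiefel_le)
qed

lemma PRW_commute:
  fixes k :: "'k::finite itself" and \<mu> \<nu> :: "(real ^ 'd) measure"
  shows "PRW k p \<mu> \<nu> = PRW k p \<nu> \<mu>"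
  unfolding PRW_def by (simp add: wasserstein_commute)

lemma PRW_triangle_empirical_mid:
  fixes k :: "'k::finite itself" and \<mu> \<rho> :: "(real ^ 'd) measure"
  assumes "p \<ge> 1" "n > 0"
  shows "PRW k p \<mu> \<rho> \<le> PRW k p \<mu> (empirical_measure n y) + PRW k p (empirical_measure n y) \<rho>"
  unfolding PRW_def
proof (rule SUP_least)
  fix E assume E: "E \<in> (stiefel :: (real ^ 'k ^ 'd) set)"
  show "wasserstein p (proj_measure E \<mu>) (proj_measure E \<rho>)
    \<le> (SUP E\<in>(stiefel :: (real ^ 'k ^ 'd) set). wasserstein p (proj_measure E \<mu>) (proj_measure E (empirical_measure n y)))
     + (SUP E\<in>(stiefel :: (real ^ 'k ^ 'd) set). wasserstein p (proj_measure E (empirical_measure n y)) (proj_measure E \<rho>))"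
    unfolding proj_measure_empirical
    by (rule order_trans[OF wasserstein_triangle_empirical_mid[OF assms] add_mono]; rule SUP_upper[OF E])
qed

lemma PRW_triangle_empirical_left:
  fixes k :: "'k::finite itself" and \<nu> \<rho> :: "(real ^ 'd) measure"
  assumes "p \<ge> 1" "n > 0" "\<rho> \<in> space (prob_algebra borel)"
  shows "PRW k p (empirical_measure n x) \<rho> \<le> PRW k p (empirical_measure n x) \<nu> + PRW k p \<nu> \<rho>"
  unfolding PRW_def
proof (rule SUP_least)
  fix E assume E: "E \<in> (stiefel :: (real ^ 'k ^ 'd) set)"
  show "wasserstein p (proj_measure E (empirical_measure n x)) (proj_measure E \<rho>)
    \<le> (SUP E\<in>(stiefel :: (real ^ 'k ^ 'd) set). wasserstein p (proj_measure E (empirical_measure n x)) (proj_measure E \<nu>))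
     + (SUP E\<in>(stiefel :: (real ^ 'k ^ 'd) set). wasserstein p (proj_measure E \<nu>) (proj_measure E \<rho>))"
    unfolding proj_measure_empirical
    by (rule order_trans[OF wasserstein_triangle_empirical_left[OF assms(1,2) proj_measure_prob[OF assms(3)]] add_mono];
        rule SUP_upper[OF E])
qed

text \<open>A supremum of lower semicontinuous functions is lower semicontinuous: the bound
  \<open>b\<close> does not depend on \<open>E\<close>.\<close>

lemma PRW_empirical_weak_limit_le:
  fixes k :: "'k::finite itself" and \<mu> :: "(real ^ 'd) measure"
  assumes p: "p \<ge> 1" and n: "n > 0"
    and prob: "\<And>j. \<mu>s j \<in> space (prob_algebra borel)" "\<mu> \<in> space (prob_algebra borel)"
    and conv: "weakly_converges \<mu>s \<mu>"
    and le: "\<And>j. PRW k p (empirical_measure n x) (\<mu>s j) \<le> b"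
  shows "PRW k p (empirical_measure n x) \<mu> \<le> b"
  unfolding PRW_def proj_measure_empirical
proof (rule SUP_least)
  fix E assume E: "E \<in> (stiefel :: (real ^ 'k ^ 'd) set)"
  show "wasserstein p (empirical_measure n (\<lambda>i. transpose E *v x i)) (proj_measure E \<mu>) \<le> b"
  proof (rule wasserstein_empirical_weak_limit_le[OF p n])
    show "weakly_converges (\<lambda>j. proj_measure E (\<mu>s j)) (proj_measure E \<mu>)"
      by (rule weakly_converges_proj_measure[OF prob conv])
    show "wasserstein p (empirical_measure n (\<lambda>i. transpose E *v x i)) (proj_measure E (\<mu>s j)) \<le> b" for j
      using le[of j] E unfolding PRW_def proj_measure_empirical by (simp add: SUP_le_iff)
  qed (simp_all add: proj_measure_prob prob)
qed

section \<open>Minimizers of uniformly approximated functions\<close>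

lemma argmin_set_iff: "\<theta> \<in> argmin_set f \<longleftrightarrow> f \<theta> \<le> (INF x. f x)" for f :: "'a \<Rightarrow> ennreal"
  unfolding argmin_set_def is_arg_min_def by (auto simp: le_INF_iff not_less)

text \<open>The deterministic core, for one fixed realization of the data. Index 0 is excluded
  because the empirical measure of no points is null. Lower semicontinuity, stated as sequential
  closedness of sublevel sets, is asked of the functions \<open>F n\<close> and not of
  \<open>G\<close>.\<close>

locale approximate_minimization =
  fixes F :: "nat \<Rightarrow> 't::metric_space \<Rightarrow> ennreal" and G :: "'t \<Rightarrow> ennreal"
    and e :: "nat \<Rightarrow> ennreal" and \<tau> :: real
  assumes e: "e \<longlonglongrightarrow> 0"
    and F_le: "\<And>n \<theta>. n > 0 \<Longrightarrow> F n \<theta> \<le> e n + G \<theta>"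
    and G_le: "\<And>n \<theta>. n > 0 \<Longrightarrow> G \<theta> \<le> e n + F n \<theta>"
    and F_lsc: "\<And>n t \<theta> b. n > 0 \<Longrightarrow> t \<longlonglongrightarrow> \<theta> \<Longrightarrow> (\<And>j. F n (t j) \<le> b) \<Longrightarrow> F n \<theta> \<le> b"
    and \<tau>: "\<tau> > 0" and level: "compact (closure {\<theta>. G \<theta> \<le> (INF \<theta>. G \<theta>) + ennreal \<tau>})"
begin

lemma INF_F_le: "n > 0 \<Longrightarrow> (INF \<theta>. F n \<theta>) \<le> e n + (INF \<theta>. G \<theta>)"
proof (cases "e n = \<top>")
  case False
  assume n: "n > 0"
  have "(INF \<theta>. F n \<theta>) - e n \<le> G \<theta>" for \<theta>
  proof -
    have "(INF \<theta>. F n \<theta>) \<le> e n + G \<theta>" using F_le[OF n, of \<theta>] by (rule INF_lower2[OF UNIV_I])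
    then show ?thesis using False by (simp add: ennreal_minus_le_iff)
  qed
  then have "(INF \<theta>. F n \<theta>) - e n \<le> (INF \<theta>. G \<theta>)" by (intro INF_greatest)
  then show ?thesis using False unfolding ennreal_minus_le_iff by blast
qed simp

lemma INF_G_le: "n > 0 \<Longrightarrow> e n < \<top> \<Longrightarrow> (INF \<theta>. G \<theta>) - e n \<le> (INF \<theta>. F n \<theta>)"
proof (rule INF_greatest)
  fix \<theta> assume n: "n > 0" and e: "e n < \<top>"
  have "(INF \<theta>. G \<theta>) \<le> e n + F n \<theta>" using G_le[OF n, of \<theta>] by (rule INF_lower2[OF UNIV_I])
  then show "(INF \<theta>. G \<theta>) - e n \<le> F n \<theta>" using e unfolding ennreal_minus_le_iff by auto
qed

lemma eventually_e_less: "c > 0 \<Longrightarrow> \<forall>\<^sub>F n in sequentially. e n < c"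
  by (rule order_tendstoD(2)[OF e])

lemma INF_tendsto: "(\<lambda>n. INF \<theta>. F n \<theta>) \<longlonglongrightarrow> (INF \<theta>. G \<theta>)"
proof (rule tendsto_sandwich)
  show "\<forall>\<^sub>F n in sequentially. (INF \<theta>. G \<theta>) - e n \<le> (INF \<theta>. F n \<theta>)"
    using eventually_gt_at_top[of 0] eventually_e_less[OF ennreal_zero_less_top]
  proof eventually_elim
    case (elim n)
    then show ?case by (rule INF_G_le)
  qed
  show "\<forall>\<^sub>F n in sequentially. (INF \<theta>. F n \<theta>) \<le> e n + (INF \<theta>. G \<theta>)"
    using eventually_gt_at_top[of 0] by eventually_elim (rule INF_F_le)
  show "(\<lambda>n. e n + (INF \<theta>. G \<theta>)) \<longlonglongrightarrow> (INF \<theta>. G \<theta>)"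
    using tendsto_add[OF e tendsto_const] by simp
  show "(\<lambda>n. (INF \<theta>. G \<theta>) - e n) \<longlonglongrightarrow> (INF \<theta>. G \<theta>)"
  proof (cases "(INF \<theta>. G \<theta>) = \<top>")
    \<comment> \<open>\<open>\<top>\<close> minus a finite number is \<open>\<top>\<close>, so an
      infinite limiting infimum is covered once \<open>e n\<close> is finite.\<close>
    case True
    then have "\<forall>\<^sub>F n in sequentially. (INF \<theta>. G \<theta>) - e n = \<top>"
      using eventually_e_less[of \<top>] by (auto elim!: eventually_mono)
    with True show ?thesis by (simp add: tendsto_eventually)
  next
    case False
    then show ?thesis using tendsto_diff_ennreal[OF tendsto_const e, of "INF \<theta>. G \<theta>"] by simp
  qed
qed

text \<open>Minimizers of \<open>F (r j)\<close> are near-minimizers of \<open>G\<close>, because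
  both the error and the difference of the infima vanish. What remains is to pass this to the limit
  \<open>\<theta>\<close> although \<open>G\<close> is not assumed lower semicontinuous.\<close>

lemma outer_limit_argmin_subset: "outer_limit (\<lambda>n. argmin_set (F n)) \<subseteq> argmin_set G"
proof
  fix \<theta> assume "\<theta> \<in> outer_limit (\<lambda>n. argmin_set (F n))"
  then obtain r t where r: "strict_mono r" and arg: "\<And>j. t j \<in> argmin_set (F (r j))"
    and t: "t \<longlonglongrightarrow> \<theta>" unfolding outer_limit_def by blast
  have "G \<theta> \<le> (INF \<theta>. G \<theta>)"
  proof (rule ennreal_le_epsilon)
    fix \<delta> :: real assume fin: "(INF \<theta>. G \<theta>) < \<top>" and \<delta>: "0 < \<delta>"
    define I where "I = (INF \<theta>. G \<theta>)"
    have "I < I + ennreal \<delta>"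
      using fin \<delta> by (cases I) (auto simp: I_def ennreal_less_iff simp flip: ennreal_plus)
    moreover have "(\<lambda>j. e (r j) + (INF \<theta>. F (r j) \<theta>)) \<longlonglongrightarrow> 0 + I"
      unfolding I_def using LIMSEQ_subseq_LIMSEQ[OF e r] LIMSEQ_subseq_LIMSEQ[OF INF_tendsto r]
      by (intro tendsto_add) (auto simp: comp_def)
    ultimately have "\<forall>\<^sub>F j in sequentially. e (r j) + (INF \<theta>. F (r j) \<theta>) < I + ennreal \<delta>"
      by (intro order_tendstoD(2)[of _ I]) auto
    with eventually_gt_at_top[of 0] have "\<forall>\<^sub>F j in sequentially. G (t j) \<le> I + ennreal \<delta>"
    proof eventually_elim
      case (elim j)
      then have "r j > 0" using seq_suble[OF r, of j] by simp
      then have "G (t j) \<le> e (r j) + F (r j) (t j)" by (rule G_le)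
      also have "\<dots> \<le> e (r j) + (INF \<theta>. F (r j) \<theta>)"
        using arg[of j] by (intro add_left_mono) (simp add: argmin_set_iff)
      finally show ?case using elim(2) by simp
    qed
    then obtain J where J: "\<And>j. j \<ge> J \<Longrightarrow> G (t j) \<le> I + ennreal \<delta>" by (auto simp: eventually_sequentially)
    \<comment> \<open>The order of limits matters: with \<open>n\<close> fixed, lower semicontinuity
      of \<open>F n\<close> is applied along \<open>j\<close>, and only then \<open>n\<close> tends
      to infinity. Each passage between \<open>G\<close> and \<open>F n\<close> costs one
      \<open>e n\<close>.\<close>
    have "G \<theta> \<le> e n + (e n + (I + ennreal \<delta>))" if n: "n > 0" for n
    proof -
      have "F n (t (j + J)) \<le> e n + (I + ennreal \<delta>)" for j
        using F_le[OF n, of "t (j + J)"] J[of "j + J"] by (meson add_left_mono le_add2 order_trans)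
      then have "F n \<theta> \<le> e n + (I + ennreal \<delta>)"
        using F_lsc[OF n LIMSEQ_ignore_initial_segment[OF t, of J]] by blast
      then show ?thesis using G_le[OF n, of \<theta>] by (meson add_left_mono order_trans)
    qed
    then have "\<exists>N. \<forall>n\<ge>N. G \<theta> \<le> e n + (e n + (I + ennreal \<delta>))" by (intro exI[of _ 1]) auto
    moreover have "(\<lambda>n. e n + (e n + (I + ennreal \<delta>))) \<longlonglongrightarrow> 0 + (0 + (I + ennreal \<delta>))"
      by (intro tendsto_add e tendsto_const)
    ultimately have "G \<theta> \<le> 0 + (0 + (I + ennreal \<delta>))" by (rule LIMSEQ_le_const[rotated])
    then show "G \<theta> \<le> (INF \<theta>. G \<theta>) + ennreal \<delta>" by (simp add: I_def)
  qed
  then show "\<theta> \<in> argmin_set G" by (simp add: argmin_set_iff)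
qed

text \<open>A minimizing sequence of \<open>F n\<close> stays in the level set of \<open>G\<close>,
  so it has a convergent subsequence. Three errors of at most \<open>\<tau> / 4\<close> add up:
  passing from \<open>F n\<close> to \<open>G\<close>, comparing the infima, and the minimization
  defect.\<close>

lemma argmin_nonempty:
  assumes n: "n > 0" and en: "e n < ennreal (\<tau> / 4)"
  shows "argmin_set (F n) \<noteq> {}"
proof (cases "(INF \<theta>. F n \<theta>) = \<top>")
  \<comment> \<open>An objective that is infinite everywhere is minimized at every point.\<close>
  case True
  then show ?thesis by (auto simp: argmin_set_iff)
next
  case False
  define I where "I = (INF \<theta>. F n \<theta>)"
  define d where "d m = \<tau> / 4 / real (Suc m)" for m
  have d: "d m > 0" "d m \<le> \<tau> / 4" for m using \<tau> by (auto simp: d_def field_simps)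
  have "I < I + ennreal (d m)" for m
    using False d[of m] by (cases I) (auto simp: I_def ennreal_less_iff simp flip: ennreal_plus)
  then have "\<exists>\<theta>. F n \<theta> < I + ennreal (d m)" for m
    unfolding I_def by (metis INF_less_iff UNIV_I)
  then obtain t where t: "\<And>m. F n (t m) < I + ennreal (d m)" by metis
  define L where "L = {\<theta>. G \<theta> \<le> (INF \<theta>. G \<theta>) + ennreal \<tau>}"
  have "t m \<in> L" for m
  proof -
    have "G (t m) \<le> e n + F n (t m)" by (rule G_le[OF n])
    also have "\<dots> \<le> ennreal (\<tau> / 4) + ((ennreal (\<tau> / 4) + (INF \<theta>. G \<theta>)) + ennreal (\<tau> / 4))"
    proof (intro add_mono less_imp_le[OF en])
      have "F n (t m) \<le> I + ennreal (d m)" using t less_imp_le by blast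
      also have "\<dots> \<le> (ennreal (\<tau> / 4) + (INF \<theta>. G \<theta>)) + ennreal (\<tau> / 4)"
        unfolding I_def
        by (intro add_mono ennreal_leI d order_trans[OF INF_F_le[OF n]] less_imp_le[OF en] order_refl)
      finally show "F n (t m) \<le> (ennreal (\<tau> / 4) + (INF \<theta>. G \<theta>)) + ennreal (\<tau> / 4)" .
    qed
    also have "\<dots> = (INF \<theta>. G \<theta>) + (ennreal (\<tau> / 4) + ennreal (\<tau> / 4) + ennreal (\<tau> / 4))"
      by (simp only: add_ac)
    also have "\<dots> \<le> (INF \<theta>. G \<theta>) + ennreal \<tau>"
    proof (rule add_left_mono)
      have "ennreal (\<tau> / 4) + ennreal (\<tau> / 4) + ennreal (\<tau> / 4) = ennreal (3 * \<tau> / 4)"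
        using \<tau> by (simp flip: ennreal_plus)
      also have "\<dots> \<le> ennreal \<tau>" using \<tau> by (intro ennreal_leI) simp
      finally show "ennreal (\<tau> / 4) + ennreal (\<tau> / 4) + ennreal (\<tau> / 4) \<le> ennreal \<tau>" .
    qed
    finally show ?thesis by (simp add: L_def)
  qed
  then have "\<forall>m. t m \<in> closure L" using closure_subset by blast
  then obtain \<theta> s where s: "strict_mono s" "(t \<circ> s) \<longlonglongrightarrow> \<theta>"
    using level unfolding L_def[symmetric] compact_eq_seq_compact_metric seq_compact_def by metis
  have "F n \<theta> \<le> I + ennreal (d m)" for m
  proof (rule F_lsc[OF n LIMSEQ_ignore_initial_segment[OF s(2), of m]])
    fix j
    \<comment> \<open>A strictly increasing \<open>s\<close> satisfies
      \<open>s (j + m) \<ge> m\<close>, so the defects along this tail are at most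
      \<open>d m\<close>.\<close>
    have "d (s (j + m)) \<le> d m"
      unfolding d_def using \<tau> seq_suble[OF s(1), of "j + m"] by (intro divide_left_mono) auto
    then show "F n ((t \<circ> s) (j + m)) \<le> I + ennreal (d m)"
      using t[of "s (j + m)"] by (simp add: order_trans[OF less_imp_le add_left_mono] ennreal_leI)
  qed
  moreover have "(\<lambda>m. I + ennreal (d m)) \<longlonglongrightarrow> I + ennreal 0"
  proof (intro tendsto_add tendsto_const tendsto_ennrealI)
    show "d \<longlonglongrightarrow> 0"
      unfolding d_def[abs_def] using LIMSEQ_Suc[OF lim_const_over_n[of "\<tau> / 4"]] by simp
  qed
  ultimately have "F n \<theta> \<le> I + ennreal 0" by (intro LIMSEQ_le_const) auto
  then have "\<theta> \<in> argmin_set (F n)" by (simp add: argmin_set_iff I_def)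
  then show ?thesis by blast
qed

lemma eventually_argmin_nonempty: "\<exists>N>0. \<forall>n\<ge>N. argmin_set (F n) \<noteq> {}"
proof -
  obtain N where N: "\<And>n. n \<ge> N \<Longrightarrow> e n < ennreal (\<tau> / 4)"
    using eventually_e_less[of "ennreal (\<tau> / 4)"] \<tau> by (auto simp: eventually_sequentially)
  \<comment> \<open>\<open>Suc N\<close> also ensures \<open>n > 0\<close>.\<close>
  have "argmin_set (F n) \<noteq> {}" if "n \<ge> Suc N" for n
    using that by (intro argmin_nonempty N) auto
  then show ?thesis by (intro exI[of _ "Suc N"]) simp
qed

end

section \<open>Almost sure convergence of infima and minimizers\<close>

theorem theorem3p9:
  fixes P :: "'w measure"
    and X :: "nat \<Rightarrow> 'w \<Rightarrow> real ^ 'd"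
    and mu_star :: "(real ^ 'd) measure"
    and mu :: "'t::polish_space \<Rightarrow> (real ^ 'd) measure"
    and p :: real
  assumes dim: "CARD('k::finite) \<le> CARD('d)"
    and p: "p \<ge> 1"
    and sigma_compact: "sigma_compact (UNIV :: 't set)"
    and proper: "closed_bounded_compact TYPE('t)"
    and model: "\<And>\<theta>. mu \<theta> \<in> space (prob_algebra borel)"
    and identifiable: "inj mu"
    and prob_space: "prob_space P"
    and star: "mu_star \<in> space (prob_algebra borel)"
    and indep: "prob_space.indep_vars P (\<lambda>_. borel) X {1..}"
    and law: "\<And>i. i \<ge> 1 \<Longrightarrow> distr P borel (X i) = mu_star"
    and data: "AE \<omega> in P.
        (\<lambda>n. wasserstein p (empirical_measure n (\<lambda>i. X i \<omega>)) mu_star) \<longlonglongrightarrow> 0"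
    and cont: "\<And>t \<theta>. t \<longlonglongrightarrow> \<theta> \<Longrightarrow> weakly_converges (\<lambda>n. mu (t n)) (mu \<theta>)"
    and level: "\<exists>\<tau>::real. \<tau> > 0 \<and>
        bounded {\<theta>. PRW TYPE('k) p mu_star (mu \<theta>)
                      \<le> (INF \<theta>'. PRW TYPE('k) p mu_star (mu \<theta>')) + ennreal \<tau>}"
  shows "\<exists>\<Omega>\<in>sets P. emeasure P \<Omega> = 1 \<and> (\<forall>\<omega>\<in>\<Omega>.
      (\<lambda>n. INF \<theta>. PRW TYPE('k) p (empirical_measure n (\<lambda>i. X i \<omega>)) (mu \<theta>))
          \<longlonglongrightarrow> (INF \<theta>. PRW TYPE('k) p mu_star (mu \<theta>))
    \<and> outer_limit (\<lambda>n. argmin_set (\<lambda>\<theta>. PRW TYPE('k) p (empirical_measure n (\<lambda>i. X i \<omega>)) (mu \<theta>)))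
          \<subseteq> argmin_set (\<lambda>\<theta>. PRW TYPE('k) p mu_star (mu \<theta>))
    \<and> (\<exists>N>0. \<forall>n\<ge>N.
          argmin_set (\<lambda>\<theta>. PRW TYPE('k) p (empirical_measure n (\<lambda>i. X i \<omega>)) (mu \<theta>)) \<noteq> {}))"
proof -
  interpret prob_space P by fact
  obtain \<tau> :: real where \<tau>: "\<tau> > 0" and bdd: "bounded {\<theta>. PRW TYPE('k) p mu_star (mu \<theta>)
      \<le> (INF \<theta>'. PRW TYPE('k) p mu_star (mu \<theta>')) + ennreal \<tau>}"
    using level by blast
  have compact: "compact (closure {\<theta>. PRW TYPE('k) p mu_star (mu \<theta>)
      \<le> (INF \<theta>'. PRW TYPE('k) p mu_star (mu \<theta>')) + ennreal \<tau>})"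
    using proper bounded_closure[OF bdd] closed_closure unfolding closed_bounded_compact_def by blast
  \<comment> \<open>The event is the complement of a measurable null set that covers the exceptional
    set, so no measurability of the latter is needed.\<close>
  obtain N where N: "{\<omega> \<in> space P. \<not> (\<lambda>n. wasserstein p (empirical_measure n (\<lambda>i. X i \<omega>)) mu_star) \<longlonglongrightarrow> 0} \<subseteq> N"
    "emeasure P N = 0" "N \<in> sets P"
    using AE_E[OF data] by blast
  show ?thesis
  proof (intro bexI[of _ "space P - N"] conjI ballI)
    show "space P - N \<in> sets P" using N by auto
    show "emeasure P (space P - N) = 1"
      using N emeasure_space_1 by (simp add: emeasure_compl)
    fix \<omega> assume \<omega>: "\<omega> \<in> space P - N"
    let ?e = "\<lambda>n. empirical_measure n (\<lambda>i. X i \<omega>)"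
    have "(\<lambda>n. wasserstein p (?e n) mu_star) \<longlonglongrightarrow> 0" using N(1) \<omega> by blast
    then have PRW_0: "(\<lambda>n. PRW TYPE('k) p (?e n) mu_star) \<longlonglongrightarrow> 0"
      using tendsto_sandwich[of "\<lambda>_. 0" "\<lambda>n. PRW TYPE('k) p (?e n) mu_star" sequentially
          "\<lambda>n. wasserstein p (?e n) mu_star" 0]
      by (simp add: PRW_le_wasserstein[OF p])
    interpret approximate_minimization "\<lambda>n \<theta>. PRW TYPE('k) p (?e n) (mu \<theta>)"
      "\<lambda>\<theta>. PRW TYPE('k) p mu_star (mu \<theta>)" "\<lambda>n. PRW TYPE('k) p (?e n) mu_star" \<tau>
    proof
      show "PRW TYPE('k) p (?e n) (mu \<theta>) \<le> PRW TYPE('k) p (?e n) mu_star + PRW TYPE('k) p mu_star (mu \<theta>)"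
        if "n > 0" for n \<theta> by (rule PRW_triangle_empirical_left[OF p that model])
      show "PRW TYPE('k) p mu_star (mu \<theta>) \<le> PRW TYPE('k) p (?e n) mu_star + PRW TYPE('k) p (?e n) (mu \<theta>)"
        if "n > 0" for n \<theta> unfolding PRW_commute[of _ p "?e n" mu_star]
        by (rule PRW_triangle_empirical_mid[OF p that])
      show "PRW TYPE('k) p (?e n) (mu \<theta>) \<le> b"
        if "n > 0" "t \<longlonglongrightarrow> \<theta>" "\<And>j. PRW TYPE('k) p (?e n) (mu (t j)) \<le> b" for n t \<theta> b
        by (rule PRW_empirical_weak_limit_le[OF p that(1) model model cont[OF that(2)] that(3)])
    qed (fact PRW_0 \<tau> compact)+
    show "(\<lambda>n. INF \<theta>. PRW TYPE('k) p (?e n) (mu \<theta>)) \<longlonglongrightarrow> (INF \<theta>. PRW TYPE('k) p mu_star (mu \<theta>))"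
      by (rule INF_tendsto)
    show "outer_limit (\<lambda>n. argmin_set (\<lambda>\<theta>. PRW TYPE('k) p (?e n) (mu \<theta>)))
        \<subseteq> argmin_set (\<lambda>\<theta>. PRW TYPE('k) p mu_star (mu \<theta>))"
      by (rule outer_limit_argmin_subset)
    show "\<exists>N>0. \<forall>n\<ge>N. argmin_set (\<lambda>\<theta>. PRW TYPE('k) p (?e n) (mu \<theta>)) \<noteq> {}"
      by (rule eventually_argmin_nonempty)
  qed
qed

end
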